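(* Let $g$ and $k$ be integers with $g \ge 3$ and $k \ge 2$, and let $G$ be a simple graph of order $n$ with minimum degree $\delta \geq 2k \geq 4$ and girth $g$. Let $n_1^* = n_1^*(\delta,g)$. Each of the following holds. (i) If $\lambda_{2}(G)< \delta-\frac{2k-1}{n_{1}^{*}}$, then $\tau(G)\geq k$. (ii) If $\mu_{n-1}(G)> \frac{2k-1}{n_{1}^{*}}$, then $\tau(G)\geq k$. (iii) If $q_{2}(G)< 2\delta-\frac{2k-1}{n_{1}^{*}}$, then $\tau(G)\geq k$.
   Context: All graphs are finite and simple. $\tau(G)$ denotes the maximum number of edge-disjoint spanning trees contained in $G$. For a graph $G$ with adjacency matrix $A$ and diagonal degree matrix $D$, $\lambda_i(G)$, $\mu_i(G)$ and $q_i(G)$ denote the $i$th largest eigenvalue (with multiplicity) of $A$, of the Laplacian matrix $D-A$, and of the signless Laplacian matrix $D+A$, respectively. The girth of $G$ is the length of a shortest cycle of $G$ ($\infty$ if $G$ is acyclic). For integers $\delta>0$ and $g\ge 3$, put $t=\lfloor \frac{g-1}{2}\rfloor$ and $$n_1^*=n_1^*(\delta,g)=\begin{cases}1+\delta+\sum_{i=2}^{t}(\delta-1)^{i}, & \text{if } g=2t+1,\\ 2+2(\delta-1)^{t}+\sum_{i=1}^{t-1}(\delta-1)^{i}, & \text{if } g=2t+2,\end{cases}$$ where empty sums are $0$. *)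

theory Defs
  imports
    "HOL-Library.Extended_Nat"
    "HOL-Library.Multiset"
    "Jordan_Normal_Form.Char_Poly"
begin

text \<open>A graph is given by its vertex set \<open>V\<close> and its edge set \<open>E\<close>, an edge being a
  two-element set of vertices.\<close>

definition simple_graph :: "'a set \<Rightarrow> 'a set set \<Rightarrow> bool" where
  "simple_graph V E \<longleftrightarrow> finite V \<and> (\<forall>e\<in>E. e \<subseteq> V \<and> card e = 2)"

definition vdegree :: "'a set set \<Rightarrow> 'a \<Rightarrow> nat" where
  "vdegree E v = card {e \<in> E. v \<in> e}"

definition min_degree :: "'a set \<Rightarrow> 'a set set \<Rightarrow> nat" where
  "min_degree V E = Min (vdegree E ` V)"

text \<open>A cycle is listed by its vertices, without repeating the first one at the end; its
  length is the length of the list.\<close>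

definition is_cycle :: "'a set set \<Rightarrow> 'a list \<Rightarrow> bool" where
  "is_cycle E c \<longleftrightarrow> length c \<ge> 3 \<and> distinct c \<and>
     (\<forall>i < length c. {c ! i, c ! (Suc i mod length c)} \<in> E)"

text \<open>The infimum of the empty set in \<^typ>\<open>enat\<close> is \<open>\<infinity>\<close>, the girth of an acyclic graph.\<close>

definition girth :: "'a set set \<Rightarrow> enat" where
  "girth E = (INF c \<in> {c. is_cycle E c}. enat (length c))"

definition connected_graph :: "'a set \<Rightarrow> 'a set set \<Rightarrow> bool" where
  "connected_graph V E \<longleftrightarrow> V \<noteq> {} \<and> (\<forall>u\<in>V. \<forall>v\<in>V. (u, v) \<in> {(x, y). {x, y} \<in> E}\<^sup>*)"

definition is_tree :: "'a set \<Rightarrow> 'a set set \<Rightarrow> bool" where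
  "is_tree V F \<longleftrightarrow> simple_graph V F \<and> connected_graph V F \<and> (\<nexists>c. is_cycle F c)"

text \<open>A spanning tree of \<open>(V, E)\<close> is identified with its edge set.\<close>

definition is_spanning_tree :: "'a set \<Rightarrow> 'a set set \<Rightarrow> 'a set set \<Rightarrow> bool" where
  "is_spanning_tree V E F \<longleftrightarrow> F \<subseteq> E \<and> is_tree V F"

text \<open>The maximum is over a finite set, which contains \<open>0\<close>: a family of spanning trees is a
  set of subsets of the finite set \<open>E\<close>.\<close>

definition tau :: "'a set \<Rightarrow> 'a set set \<Rightarrow> nat" where
  "tau V E = Max {card \<T> | \<T>. (\<forall>F\<in>\<T>. is_spanning_tree V E F) \<and> pairwise disjnt \<T>}"

text \<open>Matrices in \<^typ>\<open>'a mat\<close> are indexed by \<open>0, \<dots>, n - 1\<close>, so the matrices of a graph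
  depend on an enumeration of its vertices. Another enumeration conjugates them by a
  permutation matrix and leaves their characteristic polynomials unchanged.\<close>

definition vertex_list :: "'a set \<Rightarrow> 'a list" where
  "vertex_list V = (SOME vs. distinct vs \<and> set vs = V)"

definition adjacency_matrix :: "'a set \<Rightarrow> 'a set set \<Rightarrow> real mat" where
  "adjacency_matrix V E = mat (card V) (card V)
     (\<lambda>(i, j). if {vertex_list V ! i, vertex_list V ! j} \<in> E then 1 else 0)"

definition degree_matrix :: "'a set \<Rightarrow> 'a set set \<Rightarrow> real mat" where
  "degree_matrix V E = mat (card V) (card V)
     (\<lambda>(i, j). if i = j then real (vdegree E (vertex_list V ! i)) else 0)"

definition laplacian_matrix :: "'a set \<Rightarrow> 'a set set \<Rightarrow> real mat" where
  "laplacian_matrix V E = degree_matrix V E - adjacency_matrix V E"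

definition signless_laplacian_matrix :: "'a set \<Rightarrow> 'a set set \<Rightarrow> real mat" where
  "signless_laplacian_matrix V E = degree_matrix V E + adjacency_matrix V E"

text \<open>The \<open>i\<close>-th largest eigenvalue, counted with multiplicity and from \<open>i = 1\<close>. It is meant
  for symmetric real matrices, whose characteristic polynomial splits over the reals, and
  for \<open>1 \<le> i \<le> n\<close>.\<close>

definition ith_largest_eigenvalue :: "real mat \<Rightarrow> nat \<Rightarrow> real" where
  "ith_largest_eigenvalue A i = rev (sorted_list_of_multiset (proots (char_poly A))) ! (i - 1)"

definition adj_eig :: "'a set \<Rightarrow> 'a set set \<Rightarrow> nat \<Rightarrow> real" where
  "adj_eig V E i = ith_largest_eigenvalue (adjacency_matrix V E) i"

definition lap_eig :: "'a set \<Rightarrow> 'a set set \<Rightarrow> nat \<Rightarrow> real" where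
  "lap_eig V E i = ith_largest_eigenvalue (laplacian_matrix V E) i"

definition signless_eig :: "'a set \<Rightarrow> 'a set set \<Rightarrow> nat \<Rightarrow> real" where
  "signless_eig V E i = ith_largest_eigenvalue (signless_laplacian_matrix V E) i"

text \<open>Used for \<open>\<delta> > 0\<close> and \<open>g \<ge> 3\<close>, where the subtractions do not truncate. If
  \<open>g \<noteq> 2 * t + 1\<close>, then \<open>g = 2 * t + 2\<close>.\<close>

definition n1_star :: "nat \<Rightarrow> nat \<Rightarrow> nat" where
  "n1_star \<delta> g = (let t = (g - 1) div 2 in
     if g = 2 * t + 1 then 1 + \<delta> + (\<Sum>i=2..t. (\<delta> - 1) ^ i)
     else 2 + 2 * (\<delta> - 1) ^ t + (\<Sum>i=1..t - 1. (\<delta> - 1) ^ i))"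

end

theory Submission
  imports Defs "HOL-Library.Disjoint_Sets"
begin

text \<open>If \<open>G\<close> does not have \<open>k\<close> edge-disjoint spanning trees, then by the theorem of
  Nash-Williams and Tutte some partition of the vertices into \<open>s\<close> parts has at most
  \<open>k (s - 1) - 1\<close> crossing edges. Let \<open>d(X)\<close> count the edges leaving \<open>X\<close> and \<open>e(X, Y)\<close> those
  between \<open>X\<close> and \<open>Y\<close>. If \<open>X\<close> is a part with minimal \<open>d(X)\<close>, averaging over the other parts gives
  a part \<open>Y\<close> with \<open>d(X) + e(X, Y)\<close> and \<open>d(Y) + e(X, Y)\<close> at most \<open>2k - 1\<close>. A set with fewer than
  \<open>\<delta>\<close> leaving edges contains an edge whose ends have no neighbours outside, and a Moore-type
  count of the non-backtracking walks from there shows that it has at least \<open>n\<^sub>1\<^sup>*\<close>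
  vertices. Hence on the plane spanned by the indicators of \<open>X\<close> and \<open>Y\<close> the Laplacian form is at
  most \<open>(2k - 1) / n\<^sub>1\<^sup>*\<close> times the squared norm, and the spectral theorem turns this into
  bounds for all three eigenvalues. The theorem of Nash-Williams and Tutte is proved by exchanging
  edges in a packing of \<open>k\<close> forests with the largest total number of edges: the edges omitted by some
  packing reachable by exchanges span components on which every forest is connected, and these
  components form the partition.\<close>

section \<open>The second eigenvalue of a real symmetric matrix\<close>

text \<open>The Hermitian form \<open>S\<close> of an eigenvector equals \<open>a\<close> times its
  squared norm \<open>r\<close>, and the symmetry of the real matrix makes \<open>S\<close> its own
  conjugate. As \<open>r\<close> is nonzero, \<open>a\<close> is real.\<close>

lemma real_symmetric_eigenvalue_real:
  fixes A :: "real mat" and a :: complex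
  assumes A: "A \<in> carrier_mat n n" and sym: "transpose_mat A = A"
    and ev: "eigenvalue (map_mat complex_of_real A) a"
  shows "a \<in> \<real>"
proof -
  let ?A = "map_mat complex_of_real A"
  obtain v where v: "v \<in> carrier_vec n" "v \<noteq> 0\<^sub>v n" "?A *\<^sub>v v = a \<cdot>\<^sub>v v"
    using ev A unfolding eigenvalue_def eigenvector_def by auto
  have A_sym: "A $$ (i, j) = A $$ (j, i)" if "i < n" "j < n" for i j
    using sym A that by (metis carrier_matD index_transpose_mat(1))
  define S where "S = (\<Sum>i<n. \<Sum>j<n. complex_of_real (A $$ (i, j)) * v $ j * cnj (v $ i))"
  have row: "(\<Sum>j<n. complex_of_real (A $$ (i, j)) * v $ j) = a * v $ i" if "i < n" for i
  proof -
    have "(?A *\<^sub>v v) $ i = a * v $ i" using v that by simp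
    then show ?thesis using that A v(1) by (simp add: scalar_prod_def lessThan_atLeast0)
  qed
  define r where "r = (\<Sum>i<n. (cmod (v $ i))\<^sup>2)"
  have S: "S = a * complex_of_real r"
  proof -
    have "S = (\<Sum>i<n. (a * v $ i) * cnj (v $ i))"
      unfolding S_def by (intro sum.cong refl) (simp add: row flip: sum_distrib_right)
    also have "\<dots> = a * complex_of_real r"
      unfolding r_def by (simp add: sum_distrib_left mult.assoc flip: complex_norm_square)
    finally show ?thesis .
  qed
  have "cnj S = (\<Sum>i<n. \<Sum>j<n. complex_of_real (A $$ (i, j)) * cnj (v $ j) * v $ i)"
    unfolding S_def by simp
  also have "\<dots> = (\<Sum>j<n. \<Sum>i<n. complex_of_real (A $$ (i, j)) * cnj (v $ j) * v $ i)"
    by (rule sum.swap)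
  also have "\<dots> = S"
    unfolding S_def by (intro sum.cong refl) (simp add: A_sym mult_ac)
  finally have "cnj S = S" .
  moreover have "r \<noteq> 0"
  proof
    assume "r = 0"
    then have "\<forall>i<n. v $ i = 0"
      unfolding r_def by (subst (asm) sum_nonneg_eq_0_iff) auto
    then have "v = 0\<^sub>v n" using v(1) by (intro eq_vecI) auto
    then show False using v(2) by simp
  qed
  ultimately have "cnj a = a" using S by simp
  then show ?thesis using Reals_cnj_iff by blast
qed

text \<open>The complex characteristic polynomial splits and its roots are real. So this
  factorization is the image of a real one, and the embedding of real into complex polynomials is
  injective.\<close>

lemma real_symmetric_char_poly_splits:
  fixes A :: "real mat"
  assumes A: "A \<in> carrier_mat n n" and sym: "transpose_mat A = A"
  obtains es where "char_poly A = (\<Prod>e\<leftarrow>es. [:- e, 1:])"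
proof -
  let ?A = "map_mat complex_of_real A"
  have cA: "?A \<in> carrier_mat n n" using A by simp
  obtain as where as: "char_poly ?A = (\<Prod>a\<leftarrow>as. [:- a, 1:])"
    using char_poly_factorized[OF cA] by blast
  have "a \<in> \<real>" if "a \<in> set as" for a
  proof -
    have "poly (char_poly ?A) a = 0"
      using that unfolding as by (auto simp: poly_prod_list prod_list_zero_iff image_iff)
    then show ?thesis
      using real_symmetric_eigenvalue_real[OF A sym] eigenvalue_root_char_poly[OF cA] by blast
  qed
  then have as_real: "map (complex_of_real \<circ> Re) as = as" by (intro map_idI) simp
  interpret of_real_poly_hom: map_poly_inj_idom_hom complex_of_real ..
  have "map_poly complex_of_real (char_poly A) = char_poly ?A"
    by (rule of_real_hom.char_poly_hom[OF A, symmetric])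
  also have "\<dots> = (\<Prod>e\<leftarrow>map Re as. [:- complex_of_real e, 1:])"
    unfolding as by (subst as_real[symmetric]) (simp add: o_def)
  also have "\<dots> = map_poly complex_of_real (\<Prod>e\<leftarrow>map Re as. [:- e, 1:])"
    unfolding of_real_poly_hom.hom_prod_list by (simp add: o_def of_real_hom.map_poly_pCons_hom)
  finally have "map_poly complex_of_real (char_poly A)
      = map_poly complex_of_real (\<Prod>e\<leftarrow>map Re as. [:- e, 1:])" .
  then have "char_poly A = (\<Prod>e\<leftarrow>map Re as. [:- e, 1:])"
    by (simp only: of_real_poly_hom.eq_iff)
  then show ?thesis by (rule that)
qed

text \<open>The Householder reflection that exchanges \<open>v\<close> with the first unit vector; for \<open>v\<close> equal
  to that unit vector the factor \<open>c\<close> is \<open>2 / 0 = 0\<close> and the reflection is the identity.\<close>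

lemma householder:
  fixes v :: "real vec"
  assumes v: "v \<in> carrier_vec n" and n: "n > 0" and unit: "v \<bullet> v = 1"
  obtains W where "W \<in> carrier_mat n n" "transpose_mat W = W" "W * W = 1\<^sub>m n" "col W 0 = v"
proof -
  define u where "u = v - unit_vec n 0"
  have u: "u \<in> carrier_vec n" using v by (simp add: u_def)
  define s where "s = (\<Sum>i<n. (u $ i)\<^sup>2)"
  define c where "c = 2 / s"
  define W where "W = mat n n (\<lambda>(i, j). of_bool (i = j) - c * u $ i * u $ j)"
  have ui: "u $ i = v $ i - of_bool (i = 0)" if "i < n" for i
    using that v n unfolding u_def by auto
  have vv: "(\<Sum>i<n. (v $ i)\<^sup>2) = 1"
    using unit v by (simp add: scalar_prod_def lessThan_atLeast0 power2_eq_square)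
  have "s = (\<Sum>i<n. (v $ i)\<^sup>2 - 2 * (of_bool (i = 0) * v $ i) + of_bool (i = 0))"
    unfolding s_def by (intro sum.cong refl) (auto simp: ui power2_eq_square algebra_simps)
  also have "\<dots> = 2 - 2 * v $ 0"
    using n by (simp add: sum.distrib sum_subtractf vv flip: sum_distrib_left)
  finally have s: "s = 2 - 2 * v $ 0" .
  \<comment> \<open>For \<open>s = 0\<close> the equation \<open>c * s = 2\<close> fails, but
    multiplied by \<open>c\<close> or by an entry of \<open>u\<close> it holds in that case too,
    since both are then zero.\<close>
  have csc: "c * s * c = 2 * c" unfolding c_def by simp
  have "u $ i = 0" if "s = 0" "i < n" for i
    using that unfolding s_def by (subst (asm) sum_nonneg_eq_0_iff) auto
  then have cu: "c * s * u $ i = 2 * u $ i" if "i < n" for i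
    using that unfolding c_def by (cases "s = 0") auto
  show ?thesis
  proof
    show "W \<in> carrier_mat n n" unfolding W_def by simp
    show "transpose_mat W = W"
      unfolding W_def by (rule eq_matI) auto
    show "W * W = 1\<^sub>m n"
    proof (rule eq_matI)
      fix i j assume "i < dim_row (1\<^sub>m n :: real mat)" "j < dim_col (1\<^sub>m n :: real mat)"
      then have ij: "i < n" "j < n" by simp_all
      have "(W * W) $$ (i, j) = (\<Sum>k<n. (of_bool (i = k) - c * u $ i * u $ k) * (of_bool (k = j) - c * u $ k * u $ j))"
        using ij by (simp add: W_def scalar_prod_def lessThan_atLeast0)
      also have "\<dots> = (\<Sum>k<n. of_bool (i = k) * of_bool (k = j) - of_bool (i = k) * (c * u $ k * u $ j)
          - of_bool (k = j) * (c * u $ i * u $ k) + c * c * u $ i * u $ j * (u $ k)\<^sup>2)"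
        by (intro sum.cong refl) (auto simp: algebra_simps power2_eq_square)
      also have "\<dots> = of_bool (i = j) - c * u $ i * u $ j - c * u $ i * u $ j + c * c * u $ i * u $ j * s"
        using ij by (simp add: sum.distrib sum_subtractf s_def sum_distrib_left)
      also have "\<dots> = of_bool (i = j) + (c * s * c - 2 * c) * (u $ i * u $ j)"
        by (simp add: algebra_simps)
      finally show "(W * W) $$ (i, j) = 1\<^sub>m n $$ (i, j)"
        using ij by (simp add: csc)
    qed (auto simp: W_def)
    show "col W 0 = v"
    proof (rule eq_vecI)
      fix i assume "i < dim_vec v"
      then have i: "i < n" using v by simp
      have "c * u $ i * u $ 0 = - (c * s * u $ i) / 2"
        using n by (simp add: s ui[of 0] field_simps)
      also have "\<dots> = - u $ i" by (simp add: cu[OF i])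
      finally have "W $$ (i, 0) = of_bool (i = 0) + u $ i" using i n by (simp add: W_def)
      then show "col W 0 $ i = v $ i"
        using i n by (simp add: W_def ui)
    qed (use v in \<open>simp add: W_def\<close>)
  qed
qed

text \<open>Induction on the list of roots: a reflection moves a unit eigenvector for the first root
  to the first basis vector, and the conjugated matrix splits into that root and a symmetric block
  with the remaining roots. The diagonal keeps the order of \<open>es\<close>, so a caller decides
  which eigenvector comes first.\<close>

theorem real_symmetric_spectral:
  fixes A :: "real mat"
  assumes "A \<in> carrier_mat n n" and "transpose_mat A = A"
    and "char_poly A = (\<Prod>e\<leftarrow>es. [:- e, 1:])"
  obtains P where "P \<in> carrier_mat n n" "transpose_mat P * P = 1\<^sub>m n"
    "A * P = P * mat_diag n ((!) es)" "length es = n"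
proof -
  have "\<exists>P \<in> carrier_mat n n. transpose_mat P * P = 1\<^sub>m n \<and> A * P = P * mat_diag n ((!) es) \<and> length es = n"
    using assms
  proof (induction es arbitrary: n A)
    case Nil
    then have "n = 0" using degree_monic_char_poly[of A n] by auto
    with Nil show ?case by (intro bexI[of _ "1\<^sub>m n"]) (auto simp: mat_diag_def intro!: eq_matI)
  next
    case (Cons e es)
    note A = Cons.prems(1) and sym = Cons.prems(2) and cp = Cons.prems(3)
    have "poly (char_poly A) e = 0" unfolding cp by simp
    then obtain w where w: "w \<in> carrier_vec n" "w \<noteq> 0\<^sub>v n" "A *\<^sub>v w = e \<cdot>\<^sub>v w"
      using eigenvalue_root_char_poly[OF A] A unfolding eigenvalue_def eigenvector_def by auto
    have n: "n > 0"
    proof (rule ccontr)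
      assume "\<not> n > 0" then show False using w by auto
    qed
    then obtain m where m: "n = Suc m" by (cases n) auto
    have ww: "w \<bullet> w > 0"
    proof -
      obtain i where "i < n" "w $ i \<noteq> 0" using w by (metis carrier_vecD eq_vecI index_zero_vec)
      then have "(\<Sum>i<n. (w $ i)\<^sup>2) > 0" by (intro sum_pos2[of _ i]) auto
      then show ?thesis using w(1) by (simp add: scalar_prod_def lessThan_atLeast0 power2_eq_square)
    qed
    define v where "v = (1 / sqrt (w \<bullet> w)) \<cdot>\<^sub>v w"
    have v: "v \<in> carrier_vec n" "A *\<^sub>v v = e \<cdot>\<^sub>v v" "v \<bullet> v = 1"
      using w A ww unfolding v_def
      by (auto simp: mult_mat_vec smult_smult_assoc mult.commute)
    obtain W where W: "W \<in> carrier_mat n n" "transpose_mat W = W" "W * W = 1\<^sub>m n" "col W 0 = v"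
      using householder[OF v(1) n v(3)] .
    \<comment> \<open>As \<open>W\<close> is symmetric and its own inverse, this is a similarity,
      which preserves the characteristic polynomial, and also a congruence, which preserves
      symmetry.\<close>
    define B where "B = W * A * W"
    have B: "B \<in> carrier_mat n n" using W A by (simp add: B_def)
    have B_sym: "transpose_mat B = B"
      unfolding B_def using W(1,2) A sym
      by (simp add: transpose_mult[of _ n n _ n] assoc_mult_mat[of _ n n _ n _ n])
    have We: "W *\<^sub>v v = unit_vec n 0"
    proof -
      have "W *\<^sub>v v = col (W * W) 0"
        unfolding W(4)[symmetric] by (rule col_mult2[OF W(1) W(1) n, symmetric])
      then show ?thesis using W n by simp
    qed
    have B0: "col B 0 = e \<cdot>\<^sub>v unit_vec n 0"
    proof -
      have "col B 0 = (W * A) *\<^sub>v v"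
        unfolding B_def W(4)[symmetric] using W(1) A n by (intro col_mult2) auto
      also have "\<dots> = W *\<^sub>v (A *\<^sub>v v)"
        using W(1) A v(1) by (intro assoc_mult_mat_vec) auto
      finally have "col B 0 = W *\<^sub>v (A *\<^sub>v v)" .
      then show ?thesis using v We W by (simp add: mult_mat_vec)
    qed
    have Bi0: "B $$ (i, 0) = e * of_bool (i = 0)" if "i < n" for i
    proof -
      have "B $$ (i, 0) = col B 0 $ i" using that n B by simp
      then show ?thesis using that n by (simp add: B0)
    qed
    have B0i: "B $$ (0, i) = e * of_bool (i = 0)" if "i < n" for i
      using Bi0[OF that] B_sym B that n by (metis carrier_matD index_transpose_mat(1))
    define C where "C = mat m m (\<lambda>(i, j). B $$ (Suc i, Suc j))"
    have C: "C \<in> carrier_mat m m" by (simp add: C_def)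
    define E where "E = mat 1 1 (\<lambda>_. e)"
    have E: "E \<in> carrier_mat 1 1" by (simp add: E_def)
    have blk: "B = four_block_mat E (0\<^sub>m 1 m) (0\<^sub>m m 1) C"
      using B by (intro eq_matI) (auto simp: m E_def C_def B0i Bi0 four_block_mat_def Let_def)
    have C_sym: "transpose_mat C = C"
    proof (rule eq_matI)
      fix i j assume "i < dim_row C" "j < dim_col C"
      then show "transpose_mat C $$ (i, j) = C $$ (i, j)"
        using B_sym B by (simp add: C_def m) (metis Suc_less_eq carrier_matD index_transpose_mat(1) m)
    qed (simp_all add: C_def)
    have "similar_mat A B"
      unfolding similar_mat_def
    proof (intro exI)
      have "W * B * W = (W * W) * A * (W * W)"
        using W(1) A unfolding B_def by (simp add: assoc_mult_mat[of _ n n _ n _ n])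
      then have "A = W * B * W" using W A by simp
      then show "similar_mat_wit A B W W" by (intro similar_mat_witI[of _ _ n]) (use W A B in auto)
    qed
    then have "char_poly A = char_poly E * char_poly C"
      using char_poly_similar char_poly_four_block_zeros_col[OF E _ C] blk by (metis zero_carrier_mat)
    moreover have "char_poly E = [:- e, 1:]"
      using char_poly_upper_triangular[OF E] by (simp add: E_def diag_mat_def upper_triangular_def)
    ultimately have "[:- e, 1:] * char_poly C = [:- e, 1:] * (\<Prod>e\<leftarrow>es. [:- e, 1:])"
      using cp by (simp only: list.map prod_list.Cons)
    then have "char_poly C = (\<Prod>e\<leftarrow>es. [:- e, 1:])"
      by (subst (asm) mult_cancel_left) simp
    from Cons.IH[OF C C_sym this] obtain P where P: "P \<in> carrier_mat m m"
      "transpose_mat P * P = 1\<^sub>m m" "C * P = P * mat_diag m ((!) es)" "length es = m" by blast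
    define Q where "Q = four_block_mat (1\<^sub>m 1) (0\<^sub>m 1 m) (0\<^sub>m m 1) P"
    have Q: "Q \<in> carrier_mat n n"
      unfolding Q_def using four_block_carrier_mat[OF one_carrier_mat[of 1] P(1)] by (simp add: m)
    have QQ: "transpose_mat Q * Q = 1\<^sub>m n"
    proof -
      have "transpose_mat Q = four_block_mat (1\<^sub>m 1) (0\<^sub>m 1 m) (0\<^sub>m m 1) (transpose_mat P)"
        unfolding Q_def by (subst transpose_four_block_mat[of _ 1 1 _ m _ m]) (use P in auto)
      then have "transpose_mat Q * Q = four_block_mat (1\<^sub>m 1) (0\<^sub>m 1 m) (0\<^sub>m m 1) (transpose_mat P * P)"
        unfolding Q_def
        by (simp, subst mult_four_block_mat[of _ 1 1 _ m _ m _ _ 1 _ m]) (use P in auto)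
      also have "\<dots> = 1\<^sub>m n" using P by (simp add: m)
      finally show ?thesis .
    qed
    have D: "mat_diag n ((!) (e # es)) = four_block_mat E (0\<^sub>m 1 m) (0\<^sub>m m 1) (mat_diag m ((!) es))"
      by (rule eq_matI) (auto simp: m mat_diag_def E_def four_block_mat_def Let_def nth_Cons split: nat.splits)
    have BQ: "B * Q = Q * mat_diag n ((!) (e # es))"
      unfolding D unfolding blk Q_def
      by (subst (1 2) mult_four_block_mat[of _ 1 1 _ m _ m _ _ 1 _ m])
        (use P C E in \<open>auto simp: left_mult_zero_mat[OF mat_diag_dim]\<close>)
    define R where "R = W * Q"
    have R: "R \<in> carrier_mat n n" using W Q by (simp add: R_def)
    have "transpose_mat R * R = transpose_mat Q * (W * W) * Q"
      unfolding R_def using W(1,2) Q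
      by (simp add: transpose_mult[of _ n n _ n] assoc_mult_mat[of _ n n _ n _ n])
    then have RR: "transpose_mat R * R = 1\<^sub>m n" using W Q QQ by simp
    have "A * R = (W * W) * A * (W * Q)" using W(1,3) A Q by (simp add: R_def)
    also have "\<dots> = W * (B * Q)" 
      using W(1) A Q by (simp add: B_def assoc_mult_mat[of _ n n _ n _ n])
    also have "\<dots> = R * mat_diag n ((!) (e # es))"
      unfolding BQ R_def using W(1) Q by (simp add: assoc_mult_mat[of _ n n _ n _ n])
    finally show ?case using R RR P(4) m by auto
  qed
  then show ?thesis using that by blast
qed

section \<open>Min-max bounds from a plane of test vectors\<close>

text \<open>Compares forms in eigenvector coordinates. Index 0 is left out because the test vector
  will be orthogonal to the first eigenvector.\<close>

lemma sum_strict_mono_square: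
  fixes f g a :: "nat \<Rightarrow> real"
  assumes less: "\<And>i. i \<in> {1..<n} \<Longrightarrow> f i < g i" and ex: "\<exists>i\<in>{1..<n}. a i \<noteq> 0"
  shows "(\<Sum>i\<in>{1..<n}. f i * (a i)\<^sup>2) < (\<Sum>i\<in>{1..<n}. g i * (a i)\<^sup>2)"
proof (rule sum_strict_mono_ex1)
  show "\<forall>i\<in>{1..<n}. f i * (a i)\<^sup>2 \<le> g i * (a i)\<^sup>2"
    using less by (auto intro!: mult_right_mono less_imp_le[OF less])
  obtain i where "i \<in> {1..<n}" "a i \<noteq> 0" using ex by blast
  then show "\<exists>i\<in>{1..<n}. f i * (a i)\<^sup>2 < g i * (a i)\<^sup>2"
    using less[of i] by (intro bexI[of _ i]) simp_all
qed simp

text \<open>Some vector of a two-dimensional space is orthogonal to the first eigenvector.\<close>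

lemma real_symmetric_two_dim:
  fixes A :: "real mat"
  assumes A: "A \<in> carrier_mat n n" and sym: "transpose_mat A = A"
    and cp: "char_poly A = (\<Prod>e\<leftarrow>es. [:- e, 1:])"
    and u: "u \<in> carrier_vec n" and w: "w \<in> carrier_vec n" and n: "n > 0"
    and indep: "\<And>x y. x \<cdot>\<^sub>v u + y \<cdot>\<^sub>v w = 0\<^sub>v n \<Longrightarrow> x = 0 \<and> y = 0"
  obtains x y a where "\<exists>i\<in>{1..<n}. a i \<noteq> 0"
    "(x \<cdot>\<^sub>v u + y \<cdot>\<^sub>v w) \<bullet> (x \<cdot>\<^sub>v u + y \<cdot>\<^sub>v w) = (\<Sum>i\<in>{1..<n}. (a i)\<^sup>2)"
    "(x \<cdot>\<^sub>v u + y \<cdot>\<^sub>v w) \<bullet> (A *\<^sub>v (x \<cdot>\<^sub>v u + y \<cdot>\<^sub>v w)) = (\<Sum>i\<in>{1..<n}. es ! i * (a i)\<^sup>2)"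
proof -
  obtain P where P: "P \<in> carrier_mat n n" "transpose_mat P * P = 1\<^sub>m n"
    "A * P = P * mat_diag n ((!) es)"
    using real_symmetric_spectral[OF A sym cp] .
  have PP: "P * transpose_mat P = 1\<^sub>m n"
    using mat_mult_left_right_inverse[OF _ P(1,2)] P(1) by simp
  define p where "p = col P 0"
  have p: "p \<in> carrier_vec n" using P n by (simp add: p_def)
  \<comment> \<open>One linear equation in two unknowns has a nontrivial solution.\<close>
  obtain x y where xy: "x \<noteq> 0 \<or> y \<noteq> 0" "x * (p \<bullet> u) + y * (p \<bullet> w) = 0"
  proof (cases "p \<bullet> u = 0")
    case True then show ?thesis using that[of 1 0] by simp
  next
    case False
    then show ?thesis using that[of "p \<bullet> w" "- (p \<bullet> u)"] by simp
  qed
  define f where "f = x \<cdot>\<^sub>v u + y \<cdot>\<^sub>v w"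
  have f: "f \<in> carrier_vec n" using u w by (simp add: f_def)
  have "f \<noteq> 0\<^sub>v n" using indep xy(1) unfolding f_def by blast
  \<comment> \<open>The coordinates of \<open>f\<close> in the orthonormal eigenbasis; the choice of
    \<open>x\<close> and \<open>y\<close> makes coordinate 0 vanish.\<close>
  define a where "a = transpose_mat P *\<^sub>v f"
  have a: "a \<in> carrier_vec n"
    unfolding a_def using P(1) f by (intro mult_mat_vec_carrier) auto
  have f_eq: "f = P *\<^sub>v a"
  proof -
    have "P *\<^sub>v a = (P * transpose_mat P) *\<^sub>v f"
      unfolding a_def using P(1) f by (intro assoc_mult_mat_vec[symmetric]) auto
    then show ?thesis using PP f by simp
  qed
  have a0: "a $ 0 = 0"
  proof -
    have "a $ 0 = p \<bullet> f" using P n by (simp add: a_def p_def)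
    also have "\<dots> = x * (p \<bullet> u) + y * (p \<bullet> w)"
      using p u w by (simp add: f_def scalar_prod_add_distrib[of _ n])
    finally show ?thesis using xy(2) by simp
  qed
  have split: "(\<Sum>i<n. h i * (a $ i)\<^sup>2) = (\<Sum>i\<in>{1..<n}. h i * (a $ i)\<^sup>2)" for h :: "nat \<Rightarrow> real"
    using a0 n by (simp add: lessThan_atLeast0 sum.atLeast_Suc_lessThan[of 0])
  have move: "f \<bullet> (P *\<^sub>v z) = a \<bullet> z" if "z \<in> carrier_vec n" for z
    unfolding a_def by (rule transpose_vec_mult_scalar[OF P(1) that f, symmetric])
  have ff: "f \<bullet> f = (\<Sum>i\<in>{1..<n}. (a $ i)\<^sup>2)"
  proof -
    have "f \<bullet> f = a \<bullet> a" using move[OF a] f_eq by simp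
    also have "\<dots> = (\<Sum>i<n. 1 * (a $ i)\<^sup>2)"
      using a by (simp add: scalar_prod_def lessThan_atLeast0 power2_eq_square)
    finally show ?thesis by (subst (asm) split) simp
  qed
  have fAf: "f \<bullet> (A *\<^sub>v f) = (\<Sum>i\<in>{1..<n}. es ! i * (a $ i)\<^sup>2)"
  proof -
    have "A *\<^sub>v f = (A * P) *\<^sub>v a" using A P(1) a f_eq by simp
    also have "\<dots> = P *\<^sub>v (mat_diag n ((!) es) *\<^sub>v a)"
      unfolding P(3) using P(1) a by (intro assoc_mult_mat_vec) auto
    finally have "f \<bullet> (A *\<^sub>v f) = a \<bullet> (mat_diag n ((!) es) *\<^sub>v a)"
      using move mult_mat_vec_carrier[OF mat_diag_dim a] by simp
    also have "mat_diag n ((!) es) *\<^sub>v a = vec n (\<lambda>i. es ! i * a $ i)"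
    proof (rule eq_vecI)
      fix i assume "i < dim_vec (vec n (\<lambda>i. es ! i * a $ i))"
      then have i: "i < n" by simp
      have "(mat_diag n ((!) es) *\<^sub>v a) $ i = (\<Sum>j<n. (if i = j then es ! j else 0) * a $ j)"
        using i a by (simp add: mat_diag_def scalar_prod_def lessThan_atLeast0)
      also have "\<dots> = (\<Sum>j<n. (if j = i then es ! i * a $ i else 0))"
        by (intro sum.cong) auto
      finally show "(mat_diag n ((!) es) *\<^sub>v a) $ i = vec n (\<lambda>i. es ! i * a $ i) $ i"
        using i by simp
    qed (simp add: mat_diag_def)
    also have "a \<bullet> \<dots> = (\<Sum>i<n. es ! i * (a $ i)\<^sup>2)"
      using a by (simp add: scalar_prod_def lessThan_atLeast0 power2_eq_square mult_ac)
    finally show ?thesis by (simp add: split)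
  qed
  have "\<exists>i\<in>{1..<n}. a $ i \<noteq> 0"
  proof (rule ccontr)
    assume "\<not> ?thesis"
    then have "a $ i = 0" if "i < n" for i using a0 that by (cases i) auto
    then have "a = 0\<^sub>v n" using a by (intro eq_vecI) auto
    then have "f = 0\<^sub>v n" using f_eq P(1) by (intro eq_vecI) (auto simp: f_eq)
    with \<open>f \<noteq> 0\<^sub>v n\<close> show False by simp
  qed
  then show ?thesis using that[of "($) a" x y] ff fAf unfolding f_def by blast
qed

text \<open>Links the multiset behind \<open>ith_largest_eigenvalue\<close> to the spectral theorem:
  the roots may be listed in any order, so both sorted orders can be used below.\<close>

lemma real_symmetric_proots:
  fixes A :: "real mat"
  assumes A: "A \<in> carrier_mat n n" and sym: "transpose_mat A = A" and es: "mset es = proots (char_poly A)"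
  shows "char_poly A = (\<Prod>e\<leftarrow>es. [:- e, 1:])" and "length es = n"
proof -
  obtain es' where es': "char_poly A = (\<Prod>e\<leftarrow>es'. [:- e, 1:])"
    using real_symmetric_char_poly_splits[OF A sym] .
  have "proots (\<Prod>e\<leftarrow>es'. [:- e, 1:]) = mset es'"
  proof (induction es')
    case (Cons e es')
    have "(\<Prod>e\<leftarrow>es'. [:- e, 1:]) \<noteq> 0" by (auto simp: prod_list_zero_iff)
    then show ?case
      using Cons by (simp add: proots_mult del: mult_pCons_left)
  qed simp
  then have "mset es = mset es'" using es es' by simp
  then show *: "char_poly A = (\<Prod>e\<leftarrow>es. [:- e, 1:])"
    unfolding es' prod_mset_prod_list[symmetric] mset_map by simp
  show "length es = n"
    by (rule real_symmetric_spectral[OF A sym *])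
qed

text \<open>The Courant-Fischer argument. With the roots in descending order, the plane contains a
  nonzero vector orthogonal to an eigenvector for the largest one; if all others were below
  \<open>c\<close>, the form would be too small at that vector.\<close>

lemma second_largest_eigenvalue_ge:
  fixes A :: "real mat"
  assumes A: "A \<in> carrier_mat n n" and sym: "transpose_mat A = A"
    and u: "u \<in> carrier_vec n" and w: "w \<in> carrier_vec n" and n: "n > 0"
    and indep: "\<And>x y. x \<cdot>\<^sub>v u + y \<cdot>\<^sub>v w = 0\<^sub>v n \<Longrightarrow> x = 0 \<and> y = 0"
    and form: "\<And>x y. c * ((x \<cdot>\<^sub>v u + y \<cdot>\<^sub>v w) \<bullet> (x \<cdot>\<^sub>v u + y \<cdot>\<^sub>v w))
      \<le> (x \<cdot>\<^sub>v u + y \<cdot>\<^sub>v w) \<bullet> (A *\<^sub>v (x \<cdot>\<^sub>v u + y \<cdot>\<^sub>v w))"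
  shows "c \<le> ith_largest_eigenvalue A 2"
proof (rule ccontr)
  assume less: "\<not> c \<le> ith_largest_eigenvalue A 2"
  define es where "es = rev (sorted_list_of_multiset (proots (char_poly A)))"
  have es: "mset es = proots (char_poly A)" by (simp add: es_def)
  note * = real_symmetric_proots[OF A sym es]
  obtain x y a where a: "\<exists>i\<in>{1..<n}. a i \<noteq> 0"
    "(x \<cdot>\<^sub>v u + y \<cdot>\<^sub>v w) \<bullet> (x \<cdot>\<^sub>v u + y \<cdot>\<^sub>v w) = (\<Sum>i\<in>{1..<n}. (a i)\<^sup>2)"
    "(x \<cdot>\<^sub>v u + y \<cdot>\<^sub>v w) \<bullet> (A *\<^sub>v (x \<cdot>\<^sub>v u + y \<cdot>\<^sub>v w)) = (\<Sum>i\<in>{1..<n}. es ! i * (a i)\<^sup>2)"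
    by (rule real_symmetric_two_dim[OF A sym *(1) u w n indep])
  have "es ! i < c" if "i \<in> {1..<n}" for i
  proof -
    have "sorted (rev es)" by (simp add: es_def)
    then have "es ! i \<le> es ! 1" using that *(2) by (intro sorted_rev_nth_mono) auto
    then show ?thesis using less by (simp add: ith_largest_eigenvalue_def es_def)
  qed
  then have "(\<Sum>i\<in>{1..<n}. es ! i * (a i)\<^sup>2) < (\<Sum>i\<in>{1..<n}. c * (a i)\<^sup>2)"
    by (rule sum_strict_mono_square[OF _ a(1)])
  then show False using form[of x y] a by (simp add: sum_distrib_left)
qed

text \<open>The dual argument: the roots are listed in ascending order, so the eigenvector avoided
  belongs to the smallest one.\<close>

lemma second_smallest_eigenvalue_le:
  fixes A :: "real mat"
  assumes A: "A \<in> carrier_mat n n" and sym: "transpose_mat A = A"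
    and u: "u \<in> carrier_vec n" and w: "w \<in> carrier_vec n" and n: "n > 1"
    and indep: "\<And>x y. x \<cdot>\<^sub>v u + y \<cdot>\<^sub>v w = 0\<^sub>v n \<Longrightarrow> x = 0 \<and> y = 0"
    and form: "\<And>x y. (x \<cdot>\<^sub>v u + y \<cdot>\<^sub>v w) \<bullet> (A *\<^sub>v (x \<cdot>\<^sub>v u + y \<cdot>\<^sub>v w))
      \<le> c * ((x \<cdot>\<^sub>v u + y \<cdot>\<^sub>v w) \<bullet> (x \<cdot>\<^sub>v u + y \<cdot>\<^sub>v w))"
  shows "ith_largest_eigenvalue A (n - 1) \<le> c"
proof (rule ccontr)
  assume less: "\<not> ith_largest_eigenvalue A (n - 1) \<le> c"
  have n0: "n > 0" using n by simp
  define es where "es = sorted_list_of_multiset (proots (char_poly A))"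
  have es: "mset es = proots (char_poly A)" by (simp add: es_def)
  note * = real_symmetric_proots[OF A sym es]
  obtain x y a where a: "\<exists>i\<in>{1..<n}. a i \<noteq> 0"
    "(x \<cdot>\<^sub>v u + y \<cdot>\<^sub>v w) \<bullet> (x \<cdot>\<^sub>v u + y \<cdot>\<^sub>v w) = (\<Sum>i\<in>{1..<n}. (a i)\<^sup>2)"
    "(x \<cdot>\<^sub>v u + y \<cdot>\<^sub>v w) \<bullet> (A *\<^sub>v (x \<cdot>\<^sub>v u + y \<cdot>\<^sub>v w)) = (\<Sum>i\<in>{1..<n}. es ! i * (a i)\<^sup>2)"
    by (rule real_symmetric_two_dim[OF A sym *(1) u w n0 indep])
  \<comment> \<open>Counting from 1, the entry \<open>n - 1\<close> of the descending list has index
    \<open>n - 2\<close>, which is index 1 of the ascending list.\<close>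
  have "ith_largest_eigenvalue A (n - 1) = rev es ! (n - 2)"
    by (simp add: ith_largest_eigenvalue_def es_def numeral_2_eq_2)
  also have "\<dots> = es ! 1"
    using n *(2) by (subst rev_nth) (auto intro: arg_cong[of _ _ "(!) es"])
  finally have es1: "c < es ! 1" using less by simp
  have "c < es ! i" if "i \<in> {1..<n}" for i
  proof -
    have "sorted es" by (simp add: es_def)
    then have "es ! 1 \<le> es ! i" using that *(2) by (intro sorted_nth_mono) auto
    then show ?thesis using es1 by simp
  qed
  then have "(\<Sum>i\<in>{1..<n}. c * (a i)\<^sup>2) < (\<Sum>i\<in>{1..<n}. es ! i * (a i)\<^sup>2)"
    by (rule sum_strict_mono_square[OF _ a(1)])
  then show False using form[of x y] a by (simp add: sum_distrib_left)
qed

section \<open>Packing spanning trees\<close>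

text \<open>The closure used in \<open>connected_graph\<close>. It is an equivalence relation on the
  whole type, and the image of \<open>{v}\<close> is the component of \<open>v\<close> even if no
  edge meets \<open>v\<close>.\<close>

definition conn :: "'a set set \<Rightarrow> ('a \<times> 'a) set" where
  "conn F = {(x, y). {x, y} \<in> F}\<^sup>*"

lemma conn_refl [simp]: "(x, x) \<in> conn F"
  by (simp add: conn_def)

lemma conn_edge: "{x, y} \<in> F \<Longrightarrow> (x, y) \<in> conn F"
  by (auto simp: conn_def)

lemma conn_trans: "(x, y) \<in> conn F \<Longrightarrow> (y, z) \<in> conn F \<Longrightarrow> (x, z) \<in> conn F"
  unfolding conn_def by (rule rtrancl_trans)

lemma conn_sym: "(x, y) \<in> conn F \<Longrightarrow> (y, x) \<in> conn F"
proof -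
  have "sym {(x, y). {x, y} \<in> F}" by (auto simp: sym_def insert_commute)
  then show "(x, y) \<in> conn F \<Longrightarrow> (y, x) \<in> conn F"
    unfolding conn_def by (meson sym_rtrancl symD)
qed

lemma conn_least: "(\<And>x y. {x, y} \<in> F \<Longrightarrow> (x, y) \<in> conn G) \<Longrightarrow> conn F \<subseteq> conn G"
  unfolding conn_def by (rule rtrancl_subset_rtrancl) auto
lemma conn_mono: "F \<subseteq> G \<Longrightarrow> conn F \<subseteq> conn G"
  by (rule conn_least) (auto intro: conn_edge)

lemma conn_Image_eq_iff: "conn F `` {u} = conn F `` {v} \<longleftrightarrow> (u, v) \<in> conn F"
proof
  assume "(u, v) \<in> conn F"
  then show "conn F `` {u} = conn F `` {v}"
    by (meson Image_singleton_iff conn_sym conn_trans subset_antisym subsetI)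
next
  assume "conn F `` {u} = conn F `` {v}"
  then have "v \<in> conn F `` {u}" by simp
  then show "(u, v) \<in> conn F" by simp
qed

text \<open>Turns reasoning with symmetry and transitivity into equational reasoning.\<close>

lemma conn_eq: "(u, v) \<in> conn F \<longleftrightarrow> conn F `` {u} = conn F `` {v}"
  by (simp add: conn_Image_eq_iff)

text \<open>A walk can be shortened until it uses the new edge at most once, in one of its two
  directions.\<close>

lemma conn_insertD:
  assumes "(u, v) \<in> conn (insert {x, y} F)"
  shows "(u, v) \<in> conn F \<or> (u, x) \<in> conn F \<and> (y, v) \<in> conn F \<or> (u, y) \<in> conn F \<and> (x, v) \<in> conn F"
  using assms unfolding conn_def[of "insert _ _"]
proof (induction rule: rtrancl_induct)
  case (step v w)
  then consider "(v, w) \<in> conn F" | "v = x" "w = y" | "v = y" "w = x"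
    by (auto simp: doubleton_eq_iff intro: conn_edge)
  then show ?case
    using step.IH unfolding conn_eq by cases metis+
qed simp

lemma conn_insert_absorb:
  assumes "(x, y) \<in> conn F" shows "conn (insert {x, y} F) = conn F"
proof
  show "conn (insert {x, y} F) \<subseteq> conn F"
  proof (rule conn_least)
    fix u v assume "{u, v} \<in> insert {x, y} F"
    then show "(u, v) \<in> conn F"
      using assms conn_sym[OF assms] conn_edge[of u v F] by (auto simp: doubleton_eq_iff)
  qed
qed (rule conn_mono, blast)

lemma conn_Image_subset: "(u, v) \<in> conn F \<Longrightarrow> \<Union>F \<subseteq> V \<Longrightarrow> u \<in> V \<Longrightarrow> v \<in> V"
  unfolding conn_def by (induction rule: rtrancl_induct) auto

text \<open>Acyclicity in the form that every edge is a bridge, which suits exchanges of edges. The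
  absence of cycles follows in \<open>forest_acyclic\<close>.\<close>

definition forest :: "'a set set \<Rightarrow> bool" where
  "forest F \<longleftrightarrow> (\<forall>x y. {x, y} \<in> F \<longrightarrow> (x, y) \<notin> conn (F - {{x, y}}))"

lemma forestD: "forest F \<Longrightarrow> {x, y} \<in> F \<Longrightarrow> (x, y) \<notin> conn (F - {{x, y}})"
  unfolding forest_def by blast

lemma forest_subset: "forest F \<Longrightarrow> G \<subseteq> F \<Longrightarrow> forest G"
  unfolding forest_def by (meson Diff_mono conn_mono subset_iff subset_refl)

text \<open>If an old edge were no longer a bridge, the detour around it would use the new edge;
  together with the old edge it would join \<open>x\<close> and \<open>y\<close> inside
  \<open>F\<close>.\<close>

lemma forest_insert:
  assumes F: "forest F" and xy: "(x, y) \<notin> conn F"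
  shows "forest (insert {x, y} F)"
  unfolding forest_def
proof (intro allI impI notI)
  fix a b assume ab: "{a, b} \<in> insert {x, y} F" and c: "(a, b) \<in> conn (insert {x, y} F - {{a, b}})"
  have nxy: "{x, y} \<notin> F" using xy conn_edge[of x y F] by blast
  show False
  proof (cases "{a, b} = {x, y}")
    case True
    then have "(a, b) \<in> conn F" using c nxy by simp
    then show False using xy True conn_sym[of a b F] by (auto simp: doubleton_eq_iff)
  next
    case False
    then have F_ab: "{a, b} \<in> F" using ab by simp
    define G where "G = F - {{a, b}}"
    have G: "conn G \<subseteq> conn F" unfolding G_def by (rule conn_mono) blast
    have "insert {x, y} F - {{a, b}} = insert {x, y} G" using False unfolding G_def by auto
    then have "(a, b) \<in> conn (insert {x, y} G)" using c by simp
    moreover have "(a, b) \<notin> conn G" using forestD[OF F F_ab] unfolding G_def .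
    ultimately have "(a, x) \<in> conn F \<and> (y, b) \<in> conn F \<or> (a, y) \<in> conn F \<and> (x, b) \<in> conn F"
      using conn_insertD[of a b x y G] G by auto
    then have "(x, y) \<in> conn F"
      using conn_edge[OF F_ab] unfolding conn_eq by metis
    then show False using xy by blast
  qed
qed

text \<open>The set \<open>D\<close> plays the role of the path of \<open>F\<close> between \<open>x\<close> and \<open>y\<close>.\<close>

lemma forest_path:
  assumes F: "forest F" and fin: "finite F" and xy: "(x, y) \<in> conn F" and pair: "\<And>f. f \<in> F \<Longrightarrow> card f = 2"
  obtains D where "D \<subseteq> F" "(x, y) \<in> conn D" "\<And>f. f \<in> D \<Longrightarrow> (x, y) \<notin> conn (F - {f})"
proof -
  \<comment> \<open>A smallest connecting subset serves as the path. It needs each of its edges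
    \<open>f\<close>, so it leads from \<open>x\<close> and \<open>y\<close> to the two ends of
    \<open>f\<close>; a connection of \<open>x\<close> and \<open>y\<close> avoiding
    \<open>f\<close> would then join these ends, and \<open>f\<close> would not be a bridge.\<close>
  obtain D where D: "D \<subseteq> F" "(x, y) \<in> conn D"
    and min: "\<And>D'. D' \<subseteq> F \<Longrightarrow> (x, y) \<in> conn D' \<Longrightarrow> card D \<le> card D'"
    using ex_has_least_nat[of "\<lambda>D. D \<subseteq> F \<and> (x, y) \<in> conn D" F card] xy by blast
  show ?thesis
  proof
    fix f assume f: "f \<in> D"
    show "(x, y) \<notin> conn (F - {f})"
    proof
      assume c: "(x, y) \<in> conn (F - {f})"
      obtain a b where ab: "f = {a, b}" using pair D f by (meson card_2_iff subsetD)
      have "card (D - {f}) < card D"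
        using f D fin by (meson card_Diff1_less finite_subset)
      then have "(x, y) \<notin> conn (D - {f})" using min[of "D - {f}"] D by auto
      moreover have "(x, y) \<in> conn (insert {a, b} (D - {f}))" using D f ab by (simp add: insert_absorb)
      moreover have "conn (D - {f}) \<subseteq> conn (F - {f})" using D by (intro conn_mono) blast
      ultimately have "(x, a) \<in> conn (F - {f}) \<and> (b, y) \<in> conn (F - {f}) \<or>
          (x, b) \<in> conn (F - {f}) \<and> (a, y) \<in> conn (F - {f})"
        using conn_insertD[of x y a b "D - {f}"] by auto
      then have "(a, b) \<in> conn (F - {f})" using c unfolding conn_eq by metis
      then show False using forestD[OF F] D f ab by blast
    qed
  qed (use D in auto)
qed

text \<open>The edge closing a cycle is not a bridge, as the rest of the cycle joins its
  ends.\<close>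

lemma forest_acyclic:
  assumes F: "forest F" shows "\<not> is_cycle F c"
proof
  assume c: "is_cycle F c"
  define n where "n = length c"
  have n: "n \<ge> 3" "distinct c" and e: "\<And>i. i < n \<Longrightarrow> {c ! i, c ! (Suc i mod n)} \<in> F"
    using c unfolding is_cycle_def n_def by auto
  have idx: "c ! i = c ! j \<longleftrightarrow> i = j" if "i < n" "j < n" for i j
    using that n(2) by (simp add: n_def nth_eq_iff_index_eq)
  have last: "{c ! (n - 1), c ! 0} \<in> F" using e[of "n - 1"] n by simp
  have "(c ! 0, c ! i) \<in> conn (F - {{c ! (n - 1), c ! 0}})" if "i < n" for i
    using that
  proof (induction i)
    case (Suc i)
    \<comment> \<open>A cycle has at least three vertices, so no other edge of it coincides with the
      closing one.\<close>
    have ne: "{c ! i, c ! Suc i} \<noteq> {c ! (n - 1), c ! 0}"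
    proof
      assume "{c ! i, c ! Suc i} = {c ! (n - 1), c ! 0}"
      then have "c ! i = c ! (n - 1) \<or> c ! i = c ! 0 \<and> c ! Suc i = c ! (n - 1)"
        unfolding doubleton_eq_iff by blast
      then have "i = n - 1 \<or> i = 0 \<and> Suc i = n - 1"
        using idx[of i "n - 1"] idx[of i 0] idx[of "Suc i" "n - 1"] Suc.prems by linarith
      then show False using Suc.prems n(1) by linarith
    qed
    have "{c ! i, c ! Suc i} \<in> F" using e[of i] Suc.prems by simp
    then have "(c ! i, c ! Suc i) \<in> conn (F - {{c ! (n - 1), c ! 0}})"
      using ne by (intro conn_edge) simp
    with Suc.IH[OF Suc_lessD[OF Suc.prems]] show ?case by (rule conn_trans)
  qed simp
  from conn_sym[OF this[of "n - 1"]] show False using forestD[OF F last] n by simp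
qed

definition comps :: "'a set \<Rightarrow> 'a set set \<Rightarrow> 'a set set" where
  "comps V F = (\<lambda>v. conn F `` {v}) ` V"


text \<open>Each edge added to a forest merges two distinct components into one, so the sum stays at
  its initial value for the empty edge set.\<close>

lemma forest_card:
  assumes "finite F" "finite V" "forest F" "\<Union>F \<subseteq> V" "\<And>f. f \<in> F \<Longrightarrow> card f = 2"
  shows "card F + card (comps V F) = card V"
  using assms
proof (induction F rule: finite_induct)
  case empty
  have "conn {} = (Id :: ('a \<times> 'a) set)" by (simp add: conn_def)
  then have "comps V {} = (\<lambda>v. {v}) ` V" by (auto simp: comps_def)
  then show ?case by (simp add: card_image)
next
  case (insert f F)
  obtain x y where f: "f = {x, y}" using insert.prems(4)[of f] by (auto simp: card_2_iff)
  have xyV: "x \<in> V" "y \<in> V" using insert.prems(3) f by auto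
  have IH: "card F + card (comps V F) = card V"
    using insert.prems forest_subset[OF insert.prems(2), of F] by (intro insert.IH) auto
  have nxy: "(x, y) \<notin> conn F"
    using forestD[OF insert.prems(2), of x y] insert.hyps f by simp
  let ?X = "conn F `` {x}" and ?Y = "conn F `` {y}"
  have mem: "z \<in> ?X \<longleftrightarrow> conn F `` {z} = ?X" "z \<in> ?Y \<longleftrightarrow> conn F `` {z} = ?Y" for z
    unfolding Image_singleton_iff conn_eq by (rule eq_commute)+
  have XY: "?X \<noteq> ?Y" using nxy by (simp add: conn_Image_eq_iff)
  have sub: "conn F \<subseteq> conn (insert f F)" by (rule conn_mono) blast
  have xy: "(x, y) \<in> conn (insert f F)" using f by (intro conn_edge) simp
  have new: "conn (insert f F) `` {v} = (if v \<in> ?X \<union> ?Y then ?X \<union> ?Y else conn F `` {v})" for v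
  proof -
    have "(v, w) \<in> conn (insert f F) \<longleftrightarrow>
        (v, w) \<in> conn F \<or> (v, x) \<in> conn F \<and> (y, w) \<in> conn F \<or> (v, y) \<in> conn F \<and> (x, w) \<in> conn F" for w
    proof
      assume "(v, w) \<in> conn F \<or> (v, x) \<in> conn F \<and> (y, w) \<in> conn F \<or> (v, y) \<in> conn F \<and> (x, w) \<in> conn F"
      then have "(v, w) \<in> conn (insert f F) \<or> (v, x) \<in> conn (insert f F) \<and> (y, w) \<in> conn (insert f F)
          \<or> (v, y) \<in> conn (insert f F) \<and> (x, w) \<in> conn (insert f F)"
        using sub by blast
      then show "(v, w) \<in> conn (insert f F)" using xy unfolding conn_eq by metis
    qed (use conn_insertD[of v w x y F] f in simp)
    note ins = this
    show ?thesis
    proof (rule Set.set_eqI)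
      fix w
      have "w \<in> conn (insert f F) `` {v} \<longleftrightarrow> conn F `` {v} = conn F `` {w}
          \<or> conn F `` {v} = ?X \<and> ?Y = conn F `` {w} \<or> conn F `` {v} = ?Y \<and> ?X = conn F `` {w}"
        using ins[of w] by (simp add: conn_eq)
      moreover have "w \<in> conn F `` {v} \<longleftrightarrow> conn F `` {v} = conn F `` {w}"
        by (simp add: conn_eq)
      ultimately show "w \<in> conn (insert f F) `` {v} \<longleftrightarrow>
          w \<in> (if v \<in> ?X \<union> ?Y then ?X \<union> ?Y else conn F `` {v})"
        unfolding if_distrib[of "(\<in>) w"] Un_iff mem by (simp split: if_split) metis
    qed
  qed
  have "comps V (insert f F) = insert (?X \<union> ?Y) (comps V F - {?X, ?Y})"
  proof (intro equalityI subsetI)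
    fix C assume "C \<in> comps V (insert f F)"
    then obtain v where "v \<in> V" "C = conn (insert f F) `` {v}" by (auto simp: comps_def)
    moreover have "conn F `` {v} \<noteq> ?X" "conn F `` {v} \<noteq> ?Y" if "v \<notin> ?X \<union> ?Y"
      using that unfolding Un_iff mem by blast+
    ultimately show "C \<in> insert (?X \<union> ?Y) (comps V F - {?X, ?Y})"
      unfolding new by (auto simp: comps_def)
  next
    fix C assume "C \<in> insert (?X \<union> ?Y) (comps V F - {?X, ?Y})"
    then consider "C = ?X \<union> ?Y" | v where "v \<in> V" "C = conn F `` {v}" "C \<noteq> ?X" "C \<noteq> ?Y"
      by (auto simp: comps_def)
    then show "C \<in> comps V (insert f F)"
    proof cases
      case 1
      then have "C = conn (insert f F) `` {x}" unfolding new by simp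
      then show ?thesis using xyV by (auto simp: comps_def)
    next
      case (2 v)
      then have "v \<notin> ?X \<union> ?Y" unfolding Un_iff mem by simp
      then have "C = conn (insert f F) `` {v}" unfolding new 2 by simp
      then show ?thesis using 2 by (auto simp: comps_def)
    qed
  qed
  moreover have "?X \<union> ?Y \<notin> comps V F - {?X, ?Y}"
  proof
    assume "?X \<union> ?Y \<in> comps V F - {?X, ?Y}"
    then obtain v where v: "?X \<union> ?Y = conn F `` {v}" by (auto simp: comps_def)
    have "x \<in> conn F `` {v}" "y \<in> conn F `` {v}" unfolding v[symmetric] by simp_all
    then have "(v, x) \<in> conn F" "(v, y) \<in> conn F" by simp_all
    then show False using nxy unfolding conn_eq by metis
  qed
  moreover have fin: "finite (comps V F)" using insert.prems by (simp add: comps_def)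
  moreover have "card (comps V F - {?X, ?Y}) + 2 = card (comps V F)"
  proof -
    have "{?X, ?Y} \<subseteq> comps V F" using xyV by (auto simp: comps_def)
    then have "card (comps V F - {?X, ?Y}) = card (comps V F) - card {?X, ?Y}"
      "card {?X, ?Y} \<le> card (comps V F)"
      using fin by (auto intro!: card_Diff_subset card_mono)
    then show ?thesis using XY by simp
  qed
  ultimately show ?case using IH insert.hyps by simp
qed

lemma partition_on_comps:
  assumes "\<Union>F \<subseteq> V" shows "partition_on V (comps V F)"
proof (rule partition_onI)
  show "\<Union>(comps V F) = V"
  proof (intro equalityI subsetI)
    fix w assume "w \<in> \<Union>(comps V F)"
    then obtain v where v: "v \<in> V" "(v, w) \<in> conn F" by (auto simp: comps_def)
    show "w \<in> V" by (rule conn_Image_subset[OF v(2) assms v(1)])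
  next
    fix w assume "w \<in> V"
    then show "w \<in> \<Union>(comps V F)" by (auto simp: comps_def intro!: bexI[of _ w])
  qed
  fix p q assume "p \<in> comps V F" "q \<in> comps V F" "p \<noteq> q"
  then obtain u v where uv: "p = conn F `` {u}" "q = conn F `` {v}"
    by (auto simp: comps_def)
  then have "(u, v) \<notin> conn F" using \<open>p \<noteq> q\<close> by (simp add: conn_Image_eq_iff)
  moreover have "(u, v) \<in> conn F" if "w \<in> p" "w \<in> q" for w
    using conn_trans[of u w F v] conn_sym[of v w F] that uv by simp
  ultimately show "disjnt p q" unfolding disjnt_iff by blast
next
  show "{} \<notin> comps V F"
  proof
    assume "{} \<in> comps V F"
    then obtain v where "{} = conn F `` {v}" unfolding comps_def by (rule imageE)
    moreover have "v \<in> conn F `` {v}" by simp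
    ultimately show False by simp
  qed
qed

section \<open>Exchanges in maximum packings of forests\<close>

text \<open>The forests are indexed because several of them may be empty and because an exchange
  changes a single one.\<close>

definition packing :: "nat \<Rightarrow> 'a set set \<Rightarrow> (nat \<Rightarrow> 'a set set) \<Rightarrow> bool" where
  "packing k E F \<longleftrightarrow> (\<forall>i<k. F i \<subseteq> E \<and> forest (F i)) \<and> disjoint_family_on F {..<k}"

definition max_packing :: "nat \<Rightarrow> 'a set set \<Rightarrow> (nat \<Rightarrow> 'a set set) \<Rightarrow> bool" where
  "max_packing k E F \<longleftrightarrow> packing k E F \<and>
     (\<forall>F'. packing k E F' \<longrightarrow> (\<Sum>i<k. card (F' i)) \<le> (\<Sum>i<k. card (F i)))"

definition swap :: "nat \<Rightarrow> 'a set set \<Rightarrow> ((nat \<Rightarrow> 'a set set) \<times> (nat \<Rightarrow> 'a set set)) set" where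
  "swap k E = {(F, F'). \<exists>i<k. \<exists>e\<in>E - (\<Union>j<k. F j). \<exists>f\<in>F i.
     F' = F(i := insert e (F i - {f})) \<and> forest (F' i)}"

definition omitted :: "nat \<Rightarrow> 'a set set \<Rightarrow> (nat \<Rightarrow> 'a set set) \<Rightarrow> 'a set set" where
  "omitted k E F = (\<Union>F'\<in>(swap k E)\<^sup>* `` {F}. E - (\<Union>i<k. F' i))"

text \<open>The last premise says that \<open>G\<close> takes no edge from any forest other than
  \<open>F i\<close>, which is what disjointness requires.\<close>

lemma packing_upd:
  assumes F: "packing k E F" and i: "i < k" and G: "G \<subseteq> E" "forest G" "G \<inter> (\<Union>j<k. F j) \<subseteq> F i"
  shows "packing k E (F(i := G))"
proof -
  have "F a \<inter> F b = {}" if "a < k" "b < k" "a \<noteq> b" for a b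
    using F that unfolding packing_def disjoint_family_on_def by blast
  moreover have "G \<inter> F b = {}" if "b < k" "b \<noteq> i" for b
    using G(3) i that calculation[of i b] by blast
  ultimately show ?thesis
    using F G unfolding packing_def disjoint_family_on_def by (auto simp: Int_commute)
qed

lemma ex_max_packing:
  assumes "finite E" obtains F where "max_packing k E F"
proof -
  have empty: "packing k E (\<lambda>_. {})"
    by (simp add: packing_def disjoint_family_on_def forest_def)
  have bound: "\<forall>F. packing k E F \<longrightarrow> (\<Sum>i<k. card (F i)) < k * card E + 1"
  proof (intro allI impI)
    fix F assume "packing k E F"
    then have "(\<Sum>i<k. card (F i)) \<le> (\<Sum>i<k. card E)"
      using assms by (intro sum_mono card_mono) (auto simp: packing_def)
    then show "(\<Sum>i<k. card (F i)) < k * card E + 1" by simp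
  qed
  show ?thesis
    using ex_has_greatest_nat[OF empty bound] that unfolding max_packing_def by blast
qed

lemma max_packing_swap:
  assumes fin: "finite E" and F: "max_packing k E F" and sw: "(F, F') \<in> swap k E"
  shows "max_packing k E F'"
proof -
  obtain i e f where *: "i < k" "e \<in> E - (\<Union>j<k. F j)" "f \<in> F i"
    "F' = F(i := insert e (F i - {f}))" "forest (F' i)"
    using sw by (auto simp: swap_def)
  have pF: "packing k E F" using F by (simp add: max_packing_def)
  have FiE: "F i \<subseteq> E" using pF *(1) by (simp add: packing_def)
  have e: "e \<in> E" "e \<notin> F i" using * by auto
  have p: "packing k E F'"
    unfolding *(4)
  proof (rule packing_upd[OF pF *(1)])
    show "forest (insert e (F i - {f}))" using *(4,5) by simp
  qed (use FiE e *(2) in auto)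
  have finFi: "finite (F i)" using FiE fin finite_subset by blast
  have "card (F' j) = card (F j)" for j
    unfolding *(4) using finFi e by (cases "j = i") (simp_all add: card.remove[OF finFi *(3)])
  then have "(\<Sum>j<k. card (F' j)) = (\<Sum>j<k. card (F j))" by (rule sum.cong[OF refl])
  then show ?thesis using F p unfolding max_packing_def by presburger
qed

lemma max_packing_swaps:
  assumes "finite E" "max_packing k E F" "(F, F') \<in> (swap k E)\<^sup>*"
  shows "max_packing k E F'"
  using assms(3,2) by (induction rule: rtrancl_induct) (auto intro: max_packing_swap[OF assms(1)])

lemma simple_graph_edges:
  assumes "simple_graph V E"
  shows "finite E" "e \<in> E \<Longrightarrow> card e = 2" "\<Union>E \<subseteq> V" "finite V"
proof -
  have "E \<subseteq> Pow V" "finite V" using assms by (auto simp: simple_graph_def)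
  then show "finite E" using finite_subset by blast
qed (use assms in \<open>auto simp: simple_graph_def\<close>)

context
  fixes V :: "'a set" and E :: "'a set set" and k :: nat and F0 :: "nat \<Rightarrow> 'a set set"
  assumes graph: "simple_graph V E" and max: "max_packing k E F0"
begin

abbreviation "E0 \<equiv> omitted k E F0"

lemmas graph_edges = simple_graph_edges[OF graph]
lemma max_packing_component:
  assumes F: "max_packing k E F" and i: "i < k"
  shows "F i \<subseteq> E" "forest (F i)" "finite (F i)" "\<And>f. f \<in> F i \<Longrightarrow> card f = 2"
proof -
  show *: "F i \<subseteq> E" "forest (F i)"
    using F i unfolding max_packing_def packing_def by simp_all
  show "finite (F i)" using *(1) graph_edges(1) by (rule finite_subset)
  show "card f = 2" if "f \<in> F i" for f using * that graph_edges(2)[of f] by blast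
qed

text \<open>If \<open>x y\<close> is an unused edge, then every edge of the path of \<open>F i\<close> between its ends can be
  exchanged for it, hence is omitted as well.\<close>

lemma unused_edge_conn:
  assumes F: "(F0, F) \<in> (swap k E)\<^sup>*" and i: "i < k" and e: "{x, y} \<in> E - (\<Union>j<k. F j)"
  shows "(x, y) \<in> conn (F i \<inter> E0)"
proof -
  have maxF: "max_packing k E F" using max_packing_swaps[OF graph_edges(1) max F] .
  note Fi = max_packing_component[OF maxF i]
  have pF: "packing k E F" using maxF by (simp add: max_packing_def)
  have e_Fi: "{x, y} \<notin> F i" using e i by blast
  have "(x, y) \<in> conn (F i)"
  proof (rule ccontr)
    assume "(x, y) \<notin> conn (F i)"
    then have "forest (insert {x, y} (F i))" by (rule forest_insert[OF Fi(2)])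
    then have "packing k E (F(i := insert {x, y} (F i)))"
      using Fi(1) e by (intro packing_upd[OF pF i]) auto
    then have "(\<Sum>j<k. card ((F(i := insert {x, y} (F i))) j)) \<le> (\<Sum>j<k. card (F j))"
      using maxF unfolding max_packing_def by blast
    moreover have "(\<Sum>j<k. card ((F(i := insert {x, y} (F i))) j)) > (\<Sum>j<k. card (F j))"
      using i e_Fi Fi(3) by (intro sum_strict_mono_ex1) (auto intro!: bexI[of _ i])
    ultimately show False by simp
  qed
  then obtain D where D: "D \<subseteq> F i" "(x, y) \<in> conn D" "\<And>f. f \<in> D \<Longrightarrow> (x, y) \<notin> conn (F i - {f})"
    using forest_path[OF Fi(2,3) _ Fi(4)] by blast
  have "D \<subseteq> E0"
  proof
    fix f assume f: "f \<in> D"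
    define F' where "F' = F(i := insert {x, y} (F i - {f}))"
    have "forest (F' i)"
      unfolding F'_def using forest_insert[OF forest_subset[OF Fi(2)] D(3)[OF f]] by auto
    then have "(F, F') \<in> swap k E"
      unfolding swap_def using i e f D(1) F'_def by blast
    then have "(F0, F') \<in> (swap k E)\<^sup>*" using F by simp
    moreover have "f \<in> E - (\<Union>j<k. F' j)"
    proof -
      have "f \<notin> F j" if "j < k" "j \<noteq> i" for j
        using pF f D(1) i that unfolding packing_def disjoint_family_on_def by blast
      then show ?thesis using f D(1) Fi(1) e_Fi unfolding F'_def by auto
    qed
    ultimately show "f \<in> E0" unfolding omitted_def by blast
  qed
  then have "conn D \<subseteq> conn (F i \<inter> E0)" using D(1) by (intro conn_mono) blast
  then show ?thesis using D(2) by blast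
qed

text \<open>An exchange never creates connections inside \<open>E0\<close>: by
  \<open>unused_edge_conn\<close> the ends of the incoming edge are already joined there, and the
  outgoing edge can only remove some.\<close>

lemma swaps_conn_subset:
  assumes "(F0, F) \<in> (swap k E)\<^sup>*" and i: "i < k"
  shows "conn (F i \<inter> E0) \<subseteq> conn (F0 i \<inter> E0)"
  using assms(1)
proof (induction rule: rtrancl_induct)
  case (step F F')
  obtain j e f where *: "j < k" "e \<in> E - (\<Union>l<k. F l)" "F' = F(j := insert e (F j - {f}))"
    using step.hyps(2) by (auto simp: swap_def)
  obtain x y where xy: "e = {x, y}" using * graph_edges(2)[of e] by (auto simp: card_2_iff)
  have "conn (F' i \<inter> E0) \<subseteq> conn (F i \<inter> E0)"
  proof (cases "i = j")
    case True
    have "conn (F' i \<inter> E0) \<subseteq> conn (insert {x, y} (F i \<inter> E0))"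
      using True * xy by (intro conn_mono) auto
    also have "\<dots> = conn (F i \<inter> E0)"
      using unused_edge_conn[OF step.hyps(1) i] * xy by (intro conn_insert_absorb) auto
    finally show ?thesis .
  qed (use * in simp)
  then show ?case using step.IH by blast
qed simp

text \<open>The ends of an omitted edge are joined within \<open>E0\<close> by forest
  \<open>i\<close> of some reachable packing, hence already by \<open>F0 i\<close>. So all
  \<open>k\<close> forests, restricted to \<open>E0\<close>, have the same components as
  \<open>E0\<close>.\<close>

lemma conn_omitted:
  assumes i: "i < k" shows "conn (F0 i \<inter> E0) = conn E0"
proof
  show "conn E0 \<subseteq> conn (F0 i \<inter> E0)"
  proof (rule conn_least)
    fix x y assume "{x, y} \<in> E0"
    then obtain F where F: "(F0, F) \<in> (swap k E)\<^sup>*" "{x, y} \<in> E - (\<Union>i<k. F i)"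
      unfolding omitted_def by blast
    show "(x, y) \<in> conn (F0 i \<inter> E0)"
      using unused_edge_conn[OF F(1) i F(2)] swaps_conn_subset[OF F(1) i] by blast
  qed
qed (rule conn_mono, blast)

text \<open>If forest \<open>j\<close> has \<open>c_j\<close> components, it has
  \<open>card P - c_j\<close> edges outside \<open>E0\<close>. All edges crossing the partition
  \<open>P\<close> are among these, so \<open>cross\<close> forces the sum of the \<open>c_j\<close>
  to be at most \<open>k\<close>; as each \<open>c_j\<close> is at least 1, all are equal to
  1.\<close>

lemma max_packing_spanning:
  assumes V: "V \<noteq> {}"
    and cross: "\<And>P. partition_on V P \<Longrightarrow> k * card P \<le> card {e \<in> E. \<forall>X\<in>P. \<not> e \<subseteq> X} + k"
    and i: "i < k"
  shows "card (comps V (F0 i)) = 1"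
proof -
  note F0 = max_packing_component[OF max]
  have E0_sub: "E0 \<subseteq> E" unfolding omitted_def by blast
  have unused: "E - (\<Union>j<k. F0 j) \<subseteq> E0" unfolding omitted_def by blast
  define P where "P = comps V E0"
  have P: "partition_on V P" unfolding P_def
    using E0_sub graph_edges(3) by (intro partition_on_comps) blast
  have comps_pos: "card (comps V (F0 j)) \<ge> 1" for j
    using V graph_edges(4) by (simp add: comps_def Suc_le_eq card_gt_0_iff)
  \<comment> \<open>The difference of the counts for \<open>F0 j\<close> and for its part inside
    \<open>E0\<close>, whose components are the parts of \<open>P\<close>.\<close>
  have forest_part: "card (F0 j - E0) + card (comps V (F0 j)) = card P" if j: "j < k" for j
  proof -
    have "\<Union>(F0 j) \<subseteq> V" using F0(1)[OF j] graph_edges(3) by blast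
    then have all: "card (F0 j) + card (comps V (F0 j)) = card V"
      by (rule forest_card[OF F0(3)[OF j] graph_edges(4) F0(2)[OF j] _ F0(4)[OF j]])
    have "\<Union>(F0 j \<inter> E0) \<subseteq> V" using F0(1)[OF j] graph_edges(3) by blast
    moreover have "forest (F0 j \<inter> E0)" using F0(2)[OF j] by (rule forest_subset) simp
    ultimately have "card (F0 j \<inter> E0) + card (comps V (F0 j \<inter> E0)) = card V"
      using F0(3,4)[OF j] graph_edges(4) by (intro forest_card) simp_all
    then have "card (F0 j \<inter> E0) + card P = card V"
      unfolding P_def comps_def conn_omitted[OF j] .
    then show ?thesis using all card_Int_Diff[OF F0(3)[OF j], of E0] by simp
  qed
  have "{e \<in> E. \<forall>X\<in>P. \<not> e \<subseteq> X} \<subseteq> (\<Union>j<k. F0 j - E0)"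
  proof
    fix e assume e: "e \<in> {e \<in> E. \<forall>X\<in>P. \<not> e \<subseteq> X}"
    obtain x y where xy: "e = {x, y}" using e graph_edges(2)[of e] by (auto simp: card_2_iff)
    have "e \<notin> E0"
    proof
      assume "e \<in> E0"
      then have "e \<subseteq> conn E0 `` {x}" using conn_edge[of x y E0] xy by auto
      moreover have "conn E0 `` {x} \<in> P" using e xy graph_edges(3) by (auto simp: P_def comps_def)
      ultimately show False using e by blast
    qed
    then show "e \<in> (\<Union>j<k. F0 j - E0)" using e unused by blast
  qed
  then have "card {e \<in> E. \<forall>X\<in>P. \<not> e \<subseteq> X} \<le> card (\<Union>j<k. F0 j - E0)"
    using F0(3) by (intro card_mono) auto
  also have "\<dots> \<le> (\<Sum>j<k. card (F0 j - E0))" by (rule card_UN_le) simp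
  finally have "k * card P \<le> (\<Sum>j<k. card (F0 j - E0)) + k" using cross[OF P] by simp
  moreover have "(\<Sum>j<k. card (F0 j - E0)) + (\<Sum>j<k. card (comps V (F0 j))) = k * card P"
    using forest_part by (simp flip: sum.distrib)
  ultimately have le: "(\<Sum>j<k. card (comps V (F0 j))) \<le> k" by simp
  show ?thesis
  proof (rule ccontr)
    assume "card (comps V (F0 i)) \<noteq> 1"
    then have "card (comps V (F0 i)) > 1" using comps_pos[of i] by simp
    then have "(\<Sum>j<k. 1) < (\<Sum>j<k. card (comps V (F0 j)))"
      using comps_pos i by (intro sum_strict_mono_ex1) auto
    then show False using le by simp
  qed
qed

end

text \<open>The crossing edges are those contained in no part, and \<open>cross\<close> asks for at
  least \<open>k * (card P - 1)\<close> of them, written without subtraction. The trees are the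
  forests of a maximum packing.\<close>

theorem nash_williams_tutte:
  assumes graph: "simple_graph V E" and V: "V \<noteq> {}"
    and cross: "\<And>P. partition_on V P \<Longrightarrow> k * card P \<le> card {e \<in> E. \<forall>X\<in>P. \<not> e \<subseteq> X} + k"
  obtains F where "\<And>i. i < k \<Longrightarrow> is_spanning_tree V E (F i)" "disjoint_family_on F {..<k}"
proof -
  have "finite E" by (rule simple_graph_edges(1)[OF graph])
  then obtain F where F: "max_packing k E F" using ex_max_packing by blast
  show ?thesis
  proof
    fix i assume i: "i < k"
    note Fi = max_packing_component[OF graph F F i]
    have "connected_graph V (F i)"
      unfolding connected_graph_def conn_def[symmetric]
    proof (intro conjI ballI V)
      fix u v assume "u \<in> V" "v \<in> V"
      then have "conn (F i) `` {u} \<in> comps V (F i)" "conn (F i) `` {v} \<in> comps V (F i)"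
        by (simp_all add: comps_def)
      moreover obtain C where "comps V (F i) = {C}"
        using max_packing_spanning[OF graph F V cross i] by (auto simp: card_1_singleton_iff)
      ultimately show "(u, v) \<in> conn (F i)" by (simp add: conn_eq)
    qed
    moreover have "simple_graph V (F i)"
      using graph Fi(1) by (auto simp: simple_graph_def)
    ultimately show "is_spanning_tree V E (F i)"
      unfolding is_spanning_tree_def is_tree_def using Fi(1) forest_acyclic[OF Fi(2)] by simp
  qed (use F in \<open>simp add: max_packing_def packing_def\<close>)
qed

section \<open>Vertex sets with few leaving edges\<close>

definition nbrs :: "'a set set \<Rightarrow> 'a \<Rightarrow> 'a set" where
  "nbrs E u = {v. {u, v} \<in> E}"

definition out_degree :: "'a set set \<Rightarrow> 'a set \<Rightarrow> 'a \<Rightarrow> nat" where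
  "out_degree E X u = card (nbrs E u - X)"

text \<open>A leaving edge has exactly one end in \<open>X\<close>, so each is counted once.\<close>

definition boundary :: "'a set set \<Rightarrow> 'a set \<Rightarrow> nat" where
  "boundary E X = (\<Sum>u\<in>X. out_degree E X u)"

text \<open>Non-backtracking walks, listed with the most recent vertex first.\<close>

fun nbwalk :: "'a set set \<Rightarrow> 'a list \<Rightarrow> bool" where
  "nbwalk E [] \<longleftrightarrow> False"
| "nbwalk E [x] \<longleftrightarrow> True"
| "nbwalk E [x, y] \<longleftrightarrow> {x, y} \<in> E"
| "nbwalk E (x # y # z # w) \<longleftrightarrow> {x, y} \<in> E \<and> x \<noteq> z \<and> nbwalk E (y # z # w)"

lemma nbwalk_Cons: "w \<noteq> [] \<Longrightarrow> nbwalk E (x # w) \<longleftrightarrow>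
    {x, hd w} \<in> E \<and> nbwalk E w \<and> (tl w \<noteq> [] \<longrightarrow> x \<noteq> hd (tl w))"
  by (cases "(E, x # w)" rule: nbwalk.cases) auto

lemma nbwalk_nth:
  "nbwalk E w \<Longrightarrow> Suc i < length w \<Longrightarrow> {w ! i, w ! Suc i} \<in> E"
  "nbwalk E w \<Longrightarrow> Suc (Suc i) < length w \<Longrightarrow> w ! i \<noteq> w ! Suc (Suc i)"
  by (induction E w arbitrary: i rule: nbwalk.induct) (auto simp: nth_Cons split: nat.splits)

lemma nbwalk_suffix: "nbwalk E (r @ s) \<Longrightarrow> s \<noteq> [] \<Longrightarrow> nbwalk E s"
  by (induction r) (auto simp: nbwalk_Cons)

lemma nbwalk_prefix: "nbwalk E (r @ s) \<Longrightarrow> r \<noteq> [] \<Longrightarrow> nbwalk E r"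
proof (induction r)
  case (Cons x r)
  then show ?case by (cases r; cases "tl r") (auto simp: nbwalk_Cons)
qed simp

text \<open>Two walks arriving at \<open>b\<close> are joined by reversing one of them; as their
  vertices next to \<open>b\<close> differ, the result does not backtrack at
  \<open>b\<close>.\<close>

lemma nbwalk_glue:
  assumes "nbwalk E (b # p)" "nbwalk E (b # q)" "p \<noteq> [] \<Longrightarrow> q \<noteq> [] \<Longrightarrow> hd p \<noteq> hd q"
  shows "nbwalk E (rev p @ b # q)"
  using assms
proof (induction p arbitrary: b q)
  case (Cons x p)
  have "nbwalk E (rev p @ x # b # q)"
    using Cons.prems by (intro Cons.IH) (cases p; cases q; auto simp: insert_commute)+
  then show ?case by simp
qed simp

context
  fixes V :: "'a set" and E :: "'a set set" and g :: nat
  assumes graph: "simple_graph V E" and girth: "\<And>c. is_cycle E c \<Longrightarrow> g \<le> length c"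
begin

text \<open>If the newest vertex occurred in the distinct tail, the segment up to that occurrence
  would be a cycle with fewer than \<open>g\<close> vertices. Its length is at least 3, since loops
  and backtracking are excluded.\<close>

lemma nbwalk_distinct: "nbwalk E w \<Longrightarrow> length w \<le> g \<Longrightarrow> distinct w"
proof (induction w)
  case (Cons x w)
  show ?case
  proof (cases "w = []")
    case False
    have walk: "nbwalk E w" using Cons.prems(1) False by (simp add: nbwalk_Cons)
    then have dist: "distinct w" using Cons by simp
    have "x \<notin> set w"
    proof
      assume "x \<in> set w"
      then obtain j where j: "j < length w" "w ! j = x" by (auto simp: in_set_conv_nth)
      define c where "c = x # take j w"
      have c_nth: "c ! i = (x # w) ! i" if "i \<le> j" for i
        using that by (auto simp: c_def nth_Cons split: nat.splits)
      have len: "length c = Suc j" using j by (simp add: c_def)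
      have "j \<noteq> 0"
      proof
        assume "j = 0"
        then have "{x, x} \<in> E" using nbwalk_nth(1)[OF Cons.prems(1), of 0] j by simp
        then show False using graph by (force simp: simple_graph_def)
      qed
      moreover have "j \<noteq> 1"
        using nbwalk_nth(2)[OF Cons.prems(1), of 0] j by auto
      ultimately have "length c \<ge> 3" using len by simp
      moreover have "distinct c"
        using dist j by (auto simp: c_def in_set_conv_nth nth_eq_iff_index_eq)
      moreover have "{c ! i, c ! (Suc i mod length c)} \<in> E" if i: "i < length c" for i
      proof -
        have "c ! (Suc i mod length c) = (x # w) ! Suc i"
          using i j len c_nth[of "Suc i"] c_nth[of 0] by (cases "i = j") auto
        moreover have "{(x # w) ! i, (x # w) ! Suc i} \<in> E"
          using i j len by (intro nbwalk_nth(1)[OF Cons.prems(1)]) simp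
        ultimately show ?thesis using c_nth[of i] i len by simp
      qed
      ultimately have "is_cycle E c" by (simp add: is_cycle_def)
      then show False using girth[of c] len j Cons.prems(2) by simp
    qed
    then show ?thesis using dist by simp
  qed simp
qed simp

text \<open>Strip common vertices from the front. Where the walks diverge, gluing them at the shared
  vertex gives a non-backtracking walk of at most \<open>g\<close> vertices that contains their
  common last vertex twice.\<close>

lemma nbwalk_unique:
  assumes "nbwalk E p" "nbwalk E q" "hd p = hd q" "last p = last q" "length p + length q \<le> Suc g"
  shows "p = q"
  using assms
proof (induction p arbitrary: q)
  case (Cons b p')
  obtain q' where q: "q = b # q'" using Cons.prems by (cases q) auto
  have len: "length (b # p') \<le> g" "length (b # q') \<le> g" using Cons.prems(5) q by simp_all
  have dp: "distinct (b # p')" by (rule nbwalk_distinct) (use Cons.prems len in simp_all)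
  have dq: "distinct (b # q')" by (rule nbwalk_distinct) (use Cons.prems q len in simp_all)
  consider "p' = []" | "q' = []" | "p' \<noteq> []" "q' \<noteq> []" by blast
  then show ?case
  proof cases
    case 1
    then have "last (b # q') = b" using Cons.prems(4) q by simp
    then have "q' = []" using dq by (metis distinct.simps(2) last.simps last_in_set)
    then show ?thesis using 1 q by simp
  next
    case 2
    then have "last (b # p') = b" using Cons.prems(4) q by simp
    then have "p' = []" using dp by (metis distinct.simps(2) last.simps last_in_set)
    then show ?thesis using 2 q by simp
  next
    case 3
    show ?thesis
    proof (cases "hd p' = hd q'")
      case True
      have "p' = q'"
        using Cons.prems q 3 True by (intro Cons.IH) (auto simp: nbwalk_Cons)
      then show ?thesis using q by simp
    next
      case False
      have "nbwalk E (rev p' @ b # q')"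
        using Cons.prems(1,2) q False by (intro nbwalk_glue) auto
      then have "distinct (rev p' @ b # q')"
        by (rule nbwalk_distinct) (use Cons.prems(5) q in simp)
      moreover have "last p' \<in> set p'" "last p' \<in> set q'"
        using 3 Cons.prems(4) q last_in_set[of p'] last_in_set[of q'] by simp_all
      ultimately show ?thesis by auto
    qed
  qed
qed simp

end

section \<open>The Moore-type count inside a set with small boundary\<close>

text \<open>\<open>N i\<close> counts walks at level \<open>i\<close>, \<open>m\<close> is
  \<open>\<delta> - 1\<close>, and \<open>a i\<close> is the loss through leaving edges. A loss at
  level \<open>l\<close> is multiplied by \<open>m ^ (i - 1 - l)\<close>, at most
  \<open>m ^ (i - 2)\<close>, by level \<open>i\<close>; with total loss at most \<open>m\<close>,
  no more than \<open>m ^ (i - 1)\<close> walks are missing.\<close>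

lemma moore_recurrence:
  fixes N a :: "nat \<Rightarrow> nat"
  assumes m: "m \<ge> 1" and N1: "A \<le> N 1"
    and step: "\<And>i. 1 \<le> i \<Longrightarrow> i < t \<Longrightarrow> m * N i \<le> N (Suc i) + a i"
    and loss: "(\<Sum>i=1..<t. a i) \<le> m"
    and i: "2 \<le> i" "i \<le> t"
  shows "A * m ^ (i - 1) \<le> N i + m ^ (i - 1)"
proof -
  have strong: "A * m ^ Suc j \<le> N (Suc (Suc j)) + m ^ j * (\<Sum>l=1..<Suc (Suc j). a l)"
    if "Suc (Suc j) \<le> t" for j
    using that
  proof (induction j)
    case 0
    have "A * m \<le> m * N 1" using N1 by (simp add: mult.commute)
    also have "\<dots> \<le> N 2 + a 1" using step[of 1] 0 by (simp add: numeral_2_eq_2)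
    finally show ?case by (simp add: numeral_2_eq_2)
  next
    case (Suc j)
    define s where "s = (\<Sum>l=1..<Suc (Suc j). a l)"
    have "A * m ^ Suc (Suc j) \<le> m * (N (Suc (Suc j)) + m ^ j * s)"
      using Suc unfolding s_def by (simp add: mult.left_commute[of A m])
    also have "\<dots> \<le> N (Suc (Suc (Suc j))) + a (Suc (Suc j)) + m ^ Suc j * s"
      using step[of "Suc (Suc j)"] Suc.prems by (simp add: algebra_simps)
    also have "\<dots> \<le> N (Suc (Suc (Suc j))) + m ^ Suc j * a (Suc (Suc j)) + m ^ Suc j * s"
      using m by simp
    finally show ?case by (simp add: s_def algebra_simps)
  qed
  obtain j where j: "i = Suc (Suc j)" using i(1) by (metis Suc_le_D numeral_2_eq_2 Suc_le_mono)
  have "(\<Sum>l=1..<i. a l) \<le> (\<Sum>l=1..<t. a l)" using i by (intro sum_mono2) auto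
  then have "m ^ j * (\<Sum>l=1..<i. a l) \<le> m ^ j * m" using loss by (intro mult_left_mono) auto
  then have "m ^ j * (\<Sum>l=1..<i. a l) \<le> m ^ Suc j" by (simp add: mult.commute)
  moreover have "A * m ^ Suc j \<le> N i + m ^ j * (\<Sum>l=1..<i. a l)"
    using strong[of j] i(2) unfolding j by blast
  ultimately have "A * m ^ Suc j \<le> N i + m ^ Suc j" by linarith
  moreover have "i - 1 = Suc j" using j by simp
  ultimately show ?thesis by (simp only:)
qed

text \<open>Non-backtracking walks that prolong a seed from \<open>S\<close> by \<open>i\<close>
  vertices of \<open>X\<close>. The seeds will be one vertex for odd girth and the two orientations
  of an edge for even girth.\<close>

fun grow :: "'a set set \<Rightarrow> 'a set \<Rightarrow> 'a list set \<Rightarrow> nat \<Rightarrow> 'a list set" where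
  "grow E X S 0 = S"
| "grow E X S (Suc i) = (\<Union>w\<in>grow E X S i. (\<lambda>y. y # w) ` {y \<in> X. nbwalk E (y # w)})"

lemma grow_walk:
  assumes "\<And>s. s \<in> S \<Longrightarrow> nbwalk E s \<and> set s \<subseteq> X" and "w \<in> grow E X S i"
  shows "nbwalk E w" "set w \<subseteq> X" "\<exists>r s. s \<in> S \<and> w = r @ s \<and> length r = i"
proof -
  have "nbwalk E w \<and> set w \<subseteq> X \<and> (\<exists>r s. s \<in> S \<and> w = r @ s \<and> length r = i)"
    using assms(2)
  proof (induction i arbitrary: w)
    case 0
    then show ?case using assms(1) by auto
  next
    case (Suc i)
    then obtain y u where u: "u \<in> grow E X S i" "y \<in> X" "nbwalk E (y # u)" "w = y # u" by auto
    obtain r s where "s \<in> S" "u = r @ s" "length r = i" using Suc.IH[OF u(1)] by blast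
    then have "\<exists>r s. s \<in> S \<and> w = r @ s \<and> length r = Suc i"
      using u(4) by (intro exI[of _ "y # r"] exI[of _ s]) simp
    then show ?case using u Suc.IH[OF u(1)] by simp
  qed
  then show "nbwalk E w" "set w \<subseteq> X" "\<exists>r s. s \<in> S \<and> w = r @ s \<and> length r = i" by auto
qed

lemma finite_grow: "finite X \<Longrightarrow> finite S \<Longrightarrow> finite (grow E X S i)"
  by (induction i) auto

lemma card_grow_Suc:
  assumes "finite X" "finite S"
  shows "card (grow E X S (Suc i)) = (\<Sum>w\<in>grow E X S i. card {y \<in> X. nbwalk E (y # w)})"
proof -
  have "card (grow E X S (Suc i)) = (\<Sum>w\<in>grow E X S i. card ((\<lambda>y. y # w) ` {y \<in> X. nbwalk E (y # w)}))"
    unfolding grow.simps using assms by (intro card_UN_disjoint) (auto simp: finite_grow)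
  then show ?thesis by (simp add: card_image inj_on_def)
qed

lemma boundary_ge:
  assumes "finite X" "S \<subseteq> X" "\<And>x. x \<in> S \<Longrightarrow> 1 \<le> out_degree E X x"
  shows "card S \<le> boundary E X"
proof -
  have "card S \<le> (\<Sum>x\<in>S. out_degree E X x)"
    using sum_mono[of S "\<lambda>_. 1" "out_degree E X"] assms(3) by simp
  also have "\<dots> \<le> boundary E X"
    unfolding boundary_def using assms by (intro sum_mono2) auto
  finally show ?thesis .
qed

text \<open>In the application \<open>X\<close> is one of the two chosen parts, with boundary below
  \<open>2 * k\<close> and so below \<open>\<delta>\<close>.\<close>

locale small_boundary =
  fixes V :: "'a set" and E :: "'a set set" and g \<delta> :: nat and X :: "'a set"
  assumes graph: "simple_graph V E"
    and girth: "\<And>c. is_cycle E c \<Longrightarrow> g \<le> length c"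
    and degree: "\<And>v. v \<in> V \<Longrightarrow> \<delta> \<le> card (nbrs E v)"
    and X: "X \<subseteq> V" "X \<noteq> {}"
    and boundary: "boundary E X < \<delta>"
begin

lemma finite_X: "finite X"
  using graph X(1) finite_subset by (auto simp: simple_graph_def)

lemma finite_nbrs: "finite (nbrs E v)"
proof (rule finite_subset)
  show "nbrs E v \<subseteq> V" using graph by (auto simp: nbrs_def simple_graph_def)
  show "finite V" using graph by (simp add: simple_graph_def)
qed

lemma not_self_nbr: "v \<notin> nbrs E v"
  using graph by (force simp: nbrs_def simple_graph_def)

text \<open>If every vertex of \<open>X\<close> had a neighbour outside, then \<open>card X\<close>
  would be at most the boundary and so below \<open>\<delta>\<close>. Each vertex has at most
  \<open>card X - 1\<close> neighbours inside, which makes the boundary at least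
  \<open>card X * (\<delta> - card X + 1)\<close>, and this is at least
  \<open>\<delta>\<close>.\<close>

lemma ex_interior: obtains v where "v \<in> X" "nbrs E v \<subseteq> X"
proof -
  have "\<exists>v\<in>X. out_degree E X v = 0"
  proof (rule ccontr)
    assume "\<not> ?thesis"
    then have pos: "1 \<le> out_degree E X v" if "v \<in> X" for v using that by (simp add: Suc_le_eq)
    have cX: "card X < \<delta>" using boundary_ge[OF finite_X subset_refl pos] boundary by simp
    have "\<delta> - (card X - 1) \<le> out_degree E X v" if v: "v \<in> X" for v
    proof -
      have "nbrs E v \<subseteq> (nbrs E v - X) \<union> (X - {v})" using not_self_nbr by blast
      then have "card (nbrs E v) \<le> card ((nbrs E v - X) \<union> (X - {v}))"
        using finite_nbrs finite_X by (intro card_mono) auto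
      also have "\<dots> \<le> out_degree E X v + card (X - {v})"
        unfolding out_degree_def by (rule card_Un_le)
      finally have "card (nbrs E v) \<le> out_degree E X v + (card X - 1)"
        using v by simp
      then show ?thesis using degree[of v] v X(1) by auto
    qed
    then have "(\<Sum>v\<in>X. \<delta> - (card X - 1)) \<le> boundary E X"
      unfolding boundary_def by (intro sum_mono)
    then have le: "card X * (\<delta> - (card X - 1)) \<le> boundary E X" by simp
    have cX0: "card X \<ge> 1" using finite_X X(2) by (simp add: Suc_le_eq card_gt_0_iff)
    obtain a where a: "card X = Suc a" using cX0 by (cases "card X") auto
    obtain d where d: "\<delta> = card X + Suc d" using cX less_iff_Suc_add by auto
    have "\<delta> \<le> card X * (\<delta> - (card X - 1))" by (simp add: a d)
    then show False using le boundary by simp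
  qed
  then obtain v where "v \<in> X" "out_degree E X v = 0" by blast
  then show ?thesis using that[of v] finite_nbrs unfolding out_degree_def by simp
qed

text \<open>Otherwise each of the at least \<open>\<delta>\<close> neighbours of \<open>v\<close>
  would contribute to the boundary.\<close>

lemma ex_interior_nbr:
  assumes v: "v \<in> X" "nbrs E v \<subseteq> X"
  obtains u where "u \<in> nbrs E v" "nbrs E u \<subseteq> X"
proof -
  have "\<exists>u\<in>nbrs E v. out_degree E X u = 0"
  proof (rule ccontr)
    assume "\<not> ?thesis"
    then have "card (nbrs E v) \<le> boundary E X"
      by (intro boundary_ge[OF finite_X v(2)]) (simp add: Suc_le_eq)
    then show False using degree[of v] v X(1) boundary by auto
  qed
  then show ?thesis using that finite_nbrs unfolding out_degree_def by auto
qed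

text \<open>Of the neighbours of the newest vertex, only its predecessor is forbidden; each of the
  others extends the walk inside \<open>X\<close> or lies outside \<open>X\<close>.\<close>

lemma card_extensions:
  assumes w: "nbwalk E w" "set w \<subseteq> X" "length w \<ge> 2"
  shows "\<delta> - 1 \<le> card {y \<in> X. nbwalk E (y # w)} + out_degree E X (hd w)"
proof -
  obtain x z w' where w': "w = x # z # w'"
    using w(3) by (cases w; cases "tl w") auto
  have "nbrs E x - {z} \<subseteq> {y \<in> X. nbwalk E (y # w)} \<union> (nbrs E x - X)"
    using w(1) by (auto simp: w' nbrs_def insert_commute)
  then have "card (nbrs E x - {z}) \<le> card ({y \<in> X. nbwalk E (y # w)} \<union> (nbrs E x - X))"
    using finite_X finite_nbrs by (intro card_mono) auto
  also have "\<dots> \<le> card {y \<in> X. nbwalk E (y # w)} + out_degree E X x"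
    unfolding out_degree_def by (rule card_Un_le)
  finally have "card (nbrs E x - {z}) \<le> card {y \<in> X. nbwalk E (y # w)} + out_degree E X x" .
  moreover have "\<delta> - 1 \<le> card (nbrs E x - {z})"
  proof -
    have "\<delta> \<le> card (nbrs E x)" using w(2) X(1) by (intro degree) (auto simp: w')
    then show ?thesis using diff_card_le_card_Diff[of "{z}" "nbrs E x"] by simp
  qed
  ultimately show ?thesis by (simp add: w')
qed

context
  fixes S :: "'a list set" and t :: nat
  assumes S: "\<And>s. s \<in> S \<Longrightarrow> nbwalk E s \<and> set s \<subseteq> X" "finite S"
    and same_length: "\<And>s s'. s \<in> S \<Longrightarrow> s' \<in> S \<Longrightarrow> length s = length s'"
    and inj: "\<And>i j w w'. \<lbrakk>w \<in> grow E X S i; w' \<in> grow E X S j; i \<le> t; j \<le> t; hd w = hd w'\<rbrakk> \<Longrightarrow> w = w'"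
begin

text \<open>The levels are disjoint because all seeds have the same length, and by
  \<open>inj\<close> the newest vertices of all these walks are distinct. With \<open>f\<close>
  constantly 1 this bounds the number of walks, with \<open>f\<close> the out-degree it bounds the
  total loss.\<close>

lemma sum_grow:
  fixes f :: "'a \<Rightarrow> nat"
  assumes It: "I \<subseteq> {..t}"
  shows "(\<Sum>i\<in>I. \<Sum>w\<in>grow E X S i. f (hd w)) \<le> (\<Sum>x\<in>X. f x)"
proof -
  let ?W = "\<Union>i\<in>I. grow E X S i"
  have len: "length w = i + length s" if w: "w \<in> grow E X S i" and s: "s \<in> S" for w i s
  proof -
    obtain r s' where "s' \<in> S" "w = r @ s'" "length r = i"
      using grow_walk(3)[OF S(1) w] by blast
    then show ?thesis using same_length[OF s] by simp
  qed
  have disj: "grow E X S i \<inter> grow E X S j = {}" if "i \<noteq> j" for i j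
  proof (rule ccontr)
    assume "grow E X S i \<inter> grow E X S j \<noteq> {}"
    then obtain w where w: "w \<in> grow E X S i" "w \<in> grow E X S j" by blast
    obtain s where "s \<in> S" using grow_walk(3)[OF S(1) w(1)] by blast
    then show False using len[OF w(1)] len[OF w(2)] \<open>i \<noteq> j\<close> by simp
  qed
  have I: "finite I" using It finite_subset by blast
  have "(\<Sum>i\<in>I. \<Sum>w\<in>grow E X S i. f (hd w)) = (\<Sum>w\<in>?W. f (hd w))"
    using I disj finite_grow[OF finite_X S(2)] by (intro sum.UNION_disjoint[symmetric]) auto
  also have "\<dots> = (\<Sum>x\<in>hd ` ?W. f x)"
    using inj It by (subst sum.reindex) (auto simp: inj_on_def subset_iff)
  also have "\<dots> \<le> (\<Sum>x\<in>X. f x)"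
  proof (rule sum_mono2[OF finite_X])
    have "hd w \<in> X" if "w \<in> grow E X S i" for w i
      using grow_walk(1,2)[OF S(1) that] by (cases w) auto
    then show "hd ` ?W \<subseteq> X" by blast
  qed simp
  finally show ?thesis .
qed

lemma card_grow: "(\<Sum>i\<le>t. card (grow E X S i)) \<le> card X"
  using sum_grow[of "{..t}" "\<lambda>_. 1"] by simp

lemma loss_grow: "(\<Sum>i=1..<t. \<Sum>w\<in>grow E X S i. out_degree E X (hd w)) \<le> \<delta> - 1"
  using sum_grow[of "{1..<t}" "out_degree E X"] boundary unfolding boundary_def by force

lemma grow_step:
  assumes "\<And>s. s \<in> S \<Longrightarrow> 2 \<le> i + length s"
  shows "(\<delta> - 1) * card (grow E X S i) \<le>
    card (grow E X S (Suc i)) + (\<Sum>w\<in>grow E X S i. out_degree E X (hd w))"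
proof -
  have "(\<Sum>w\<in>grow E X S i. \<delta> - 1) \<le>
      (\<Sum>w\<in>grow E X S i. card {y \<in> X. nbwalk E (y # w)} + out_degree E X (hd w))"
  proof (intro sum_mono card_extensions)
    fix w assume w: "w \<in> grow E X S i"
    show "nbwalk E w" "set w \<subseteq> X" using grow_walk[OF S(1) w] by auto
    show "length w \<ge> 2" using grow_walk(3)[OF S(1) w] assms by auto
  qed
  then show ?thesis
    unfolding card_grow_Suc[OF finite_X S(2)] by (simp add: sum.distrib mult.commute)
qed

end

text \<open>The seed is a vertex with all neighbours in \<open>X\<close>. Level 1 has at least
  \<open>\<delta>\<close> walks, and after the loss level \<open>i\<close> keeps \<open>\<delta> *
  (\<delta> - 1) ^ (i - 1) - (\<delta> - 1) ^ (i - 1) = (\<delta> - 1) ^ i\<close>.\<close>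

lemma card_ge_odd:
  assumes g: "g = 2 * t + 1" and t: "t \<ge> 1" and \<delta>: "\<delta> \<ge> 2"
  shows "1 + \<delta> + (\<Sum>i=2..t. (\<delta> - 1) ^ i) \<le> card X"
proof -
  obtain v where v: "v \<in> X" "nbrs E v \<subseteq> X" by (rule ex_interior)
  define S where "S = {[v]}"
  have S: "\<And>s. s \<in> S \<Longrightarrow> nbwalk E s \<and> set s \<subseteq> X" "finite S"
    using v by (auto simp: S_def)
  have len: "\<And>s s'. s \<in> S \<Longrightarrow> s' \<in> S \<Longrightarrow> length s = length s'" by (simp add: S_def)
  have inj: "w = w'" if w: "w \<in> grow E X S i" "w' \<in> grow E X S j" "i \<le> t" "j \<le> t" "hd w = hd w'" for i j w w'
  proof -
    obtain r where r: "w = r @ [v]" "length r = i" using grow_walk(3)[OF S(1) w(1)] by (auto simp: S_def)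
    obtain r' where r': "w' = r' @ [v]" "length r' = j" using grow_walk(3)[OF S(1) w(2)] by (auto simp: S_def)
    \<comment> \<open>Both lists have at most \<open>t + 1\<close> entries, together at most
      \<open>2 * t + 2 = Suc g\<close>.\<close>
    show ?thesis
      by (rule nbwalk_unique[OF graph girth grow_walk(1)[OF S(1) w(1)] grow_walk(1)[OF S(1) w(2)] w(5)])
        (use r r' w(3,4) g in auto)
  qed
  define N where "N i = card (grow E X S i)" for i
  define a where "a i = (\<Sum>w\<in>grow E X S i. out_degree E X (hd w))" for i
  have N0: "N 0 = 1" by (simp add: N_def S_def)
  have "{y \<in> X. nbwalk E [y, v]} = nbrs E v" using v(2) by (auto simp: nbrs_def insert_commute)
  then have N1: "\<delta> \<le> N 1"
    using degree[of v] v X(1) by (auto simp: N_def S_def card_grow_Suc[OF finite_X] card_image inj_on_def)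
  have "(\<delta> - 1) * N i \<le> N (Suc i) + a i" if "1 \<le> i" for i
  proof -
    have two: "2 \<le> i + length s" if "s \<in> S" for s using that \<open>1 \<le> i\<close> by (simp add: S_def)
    show ?thesis unfolding N_def a_def by (rule grow_step[where t = t, OF S len inj two])
  qed
  moreover have "(\<Sum>i=1..<t. a i) \<le> \<delta> - 1"
    unfolding a_def by (rule loss_grow[OF S len inj])
  ultimately have "\<delta> * (\<delta> - 1) ^ (i - 1) \<le> N i + (\<delta> - 1) ^ (i - 1)" if "i \<in> {2..t}" for i
    using that \<delta> N1 by (intro moore_recurrence[of _ _ _ t a]) auto
  moreover have "\<delta> * (\<delta> - 1) ^ (i - 1) = (\<delta> - 1) ^ i + (\<delta> - 1) ^ (i - 1)" if "i \<in> {2..t}" for i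
    using that \<delta> by (cases i; cases \<delta>) auto
  ultimately have "(\<Sum>i=2..t. (\<delta> - 1) ^ i) \<le> (\<Sum>i=2..t. N i)"
    by (intro sum_mono) (metis add_le_cancel_right)
  moreover have "(\<Sum>i\<le>t. N i) = N 0 + N 1 + (\<Sum>i=2..t. N i)"
    using t by (simp add: atMost_atLeast0 sum.atLeast_Suc_atMost numeral_2_eq_2)
  moreover have "(\<Sum>i\<le>t. N i) \<le> card X"
    unfolding N_def by (rule card_grow[OF S len inj])
  ultimately show ?thesis using N0 N1 by simp
qed

text \<open>The seeds are the two orientations of an edge whose ends have all neighbours in
  \<open>X\<close>. Level \<open>i \<ge> 2\<close> has at least
  \<open>2 * (\<delta> - 1) ^ i - (\<delta> - 1) ^ (i - 1)\<close> walks; summing leaves the powers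
  below \<open>t\<close> once and the power \<open>t\<close> twice.\<close>

lemma card_ge_even:
  assumes g: "g = 2 * t + 2" and t: "t \<ge> 1" and \<delta>: "\<delta> \<ge> 2"
  shows "2 + 2 * (\<delta> - 1) ^ t + (\<Sum>i=1..t - 1. (\<delta> - 1) ^ i) \<le> card X"
proof -
  obtain v where v: "v \<in> X" "nbrs E v \<subseteq> X" by (rule ex_interior)
  obtain u where u: "u \<in> nbrs E v" "nbrs E u \<subseteq> X" by (rule ex_interior_nbr[OF v])
  have uv: "u \<noteq> v" "u \<in> X" "{u, v} \<in> E"
    using not_self_nbr[of v] u v by (auto simp: nbrs_def insert_commute)
  define S where "S = {[u, v], [v, u]}"
  have S: "\<And>s. s \<in> S \<Longrightarrow> nbwalk E s \<and> set s \<subseteq> X" "finite S"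
    using v uv by (auto simp: S_def insert_commute)
  have len: "\<And>s s'. s \<in> S \<Longrightarrow> s' \<in> S \<Longrightarrow> length s = length s'" by (auto simp: S_def)
  note unique = nbwalk_unique[OF graph girth]
  \<comment> \<open>The full lists can be too long for \<open>nbwalk_unique\<close>; without the
    shared last vertex \<open>y\<close> they have together at most \<open>2 * t + 2\<close>
    entries.\<close>
  have same: "r = r'" if "nbwalk E (r @ [x, y])" "nbwalk E (r' @ [x, y])" "length r \<le> t" "length r' \<le> t"
      "hd (r @ [x, y]) = hd (r' @ [x, y])" for r r' x y
  proof -
    have "r @ [x] = r' @ [x]"
    proof (rule unique)
      show "nbwalk E (r @ [x])" "nbwalk E (r' @ [x])"
        using nbwalk_prefix[of E "r @ [x]" "[y]"] nbwalk_prefix[of E "r' @ [x]" "[y]"] that by auto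
      show "hd (r @ [x]) = hd (r' @ [x])" using that(5) by (cases r; cases r') auto
    qed (use that(3,4) g in auto)
    then show ?thesis by simp
  qed
  \<comment> \<open>Dropping \<open>x\<close> from the second list makes both end in
    \<open>y\<close>, with at most \<open>2 * t + 3 = Suc g\<close> entries in all. Uniqueness then
    forces the second walk to backtrack along \<open>x, y, x\<close>.\<close>
  have diff: False if "nbwalk E (r @ [x, y])" "nbwalk E (r' @ [y, x])" "length r \<le> t" "length r' \<le> t"
      "hd (r @ [x, y]) = hd (r' @ [y, x])" for r r' x y
  proof -
    have "r @ [x, y] = r' @ [y]"
    proof (rule unique)
      show "nbwalk E (r' @ [y])" using nbwalk_prefix[of E "r' @ [y]" "[x]"] that by auto
      show "hd (r @ [x, y]) = hd (r' @ [y])" using that(5) by (cases r') auto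
    qed (use that g in auto)
    then have "r' = r @ [x]" by simp
    then have "nbwalk E [x, y, x]" using nbwalk_suffix[of E r "[x, y, x]"] that(2) by simp
    then show False by simp
  qed
  have inj: "w = w'" if w: "w \<in> grow E X S i" "w' \<in> grow E X S j" "i \<le> t" "j \<le> t" "hd w = hd w'" for i j w w'
  proof -
    obtain r s where r: "s \<in> S" "w = r @ s" "length r = i" using grow_walk(3)[OF S(1) w(1)] by blast
    obtain r' s' where r': "s' \<in> S" "w' = r' @ s'" "length r' = j" using grow_walk(3)[OF S(1) w(2)] by blast
    have walk: "nbwalk E (r @ s)" "nbwalk E (r' @ s')" "hd (r @ s) = hd (r' @ s')"
      using grow_walk(1)[OF S(1) w(1)] grow_walk(1)[OF S(1) w(2)] w(5) r r' by simp_all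
    have "s = [u, v] \<or> s = [v, u]" "s' = [u, v] \<or> s' = [v, u]" using r(1) r'(1) by (auto simp: S_def)
    then show ?thesis
      using same[of r _ _ r'] diff[of r _ _ r'] walk r r' w(3,4) by metis
  qed
  define N where "N i = card (grow E X S i)" for i
  define a where "a i = (\<Sum>w\<in>grow E X S i. out_degree E X (hd w))" for i
  have N0: "N 0 = 2" using uv by (simp add: N_def S_def)
  have step: "(\<delta> - 1) * N i \<le> N (Suc i) + a i" for i
  proof -
    have two: "2 \<le> i + length s" if "s \<in> S" for s using that by (auto simp: S_def)
    show ?thesis unfolding N_def a_def by (rule grow_step[where t = t, OF S len inj two])
  qed
  \<comment> \<open>Neither \<open>u\<close> nor \<open>v\<close> has a neighbour outside
    \<open>X\<close>, so nothing is lost on the way to level 1.\<close>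
  have "a 0 = 0"
    using u v uv by (simp add: a_def S_def out_degree_def) (metis Diff_eq_empty_iff card.empty)
  then have N1: "2 * (\<delta> - 1) \<le> N 1" using step[of 0] N0 by simp
  have "(\<Sum>i=1..<t. a i) \<le> \<delta> - 1"
    unfolding a_def by (rule loss_grow[OF S len inj])
  then have "2 * (\<delta> - 1) * (\<delta> - 1) ^ (i - 1) \<le> N i + (\<delta> - 1) ^ (i - 1)" if "i \<in> {2..t}" for i
    using that \<delta> N1 step by (intro moore_recurrence[of _ _ _ t a]) auto
  moreover have "2 * (\<delta> - 1) * (\<delta> - 1) ^ (i - 1) = 2 * (\<delta> - 1) ^ i" if "i \<in> {2..t}" for i
    using that by (cases i) auto
  ultimately have "(\<Sum>i=2..t. 2 * (\<delta> - 1) ^ i) \<le> (\<Sum>i=2..t. N i + (\<delta> - 1) ^ (i - 1))"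
    by (intro sum_mono) metis
  moreover have "(\<Sum>i=2..t. (\<delta> - 1) ^ (i - 1)) = (\<Sum>i=1..t - 1. (\<delta> - 1) ^ i)"
    by (rule sum.reindex_bij_witness[of _ Suc "\<lambda>i. i - 1"]) auto
  moreover have "(\<Sum>i\<le>t. N i) = N 0 + N 1 + (\<Sum>i=2..t. N i)"
    using t by (simp add: atMost_atLeast0 sum.atLeast_Suc_atMost numeral_2_eq_2)
  moreover have "(\<Sum>i\<le>t. N i) \<le> card X"
    unfolding N_def by (rule card_grow[OF S len inj])
  moreover have "2 * (\<delta> - 1) + (\<Sum>i=2..t. 2 * (\<delta> - 1) ^ i) = 2 * (\<Sum>i=1..t - 1. (\<delta> - 1) ^ i) + 2 * (\<delta> - 1) ^ t"
    (is "?l = ?r")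
  proof -
    have "(\<Sum>i=1..t. (\<delta> - 1) ^ i) = (\<delta> - 1) + (\<Sum>i=2..t. (\<delta> - 1) ^ i)"
      using t sum.atLeast_Suc_atMost[of 1 t "\<lambda>i. (\<delta> - 1) ^ i"] by (simp add: numeral_2_eq_2)
    then have "?l = 2 * (\<Sum>i=1..t. (\<delta> - 1) ^ i)"
      by (simp flip: sum_distrib_left)
    also have "\<dots> = ?r" using t by (cases t) auto
    finally show ?thesis .
  qed
  ultimately show ?thesis using N0 N1 by (simp add: sum.distrib)
qed

lemma n1_star_le_card:
  assumes "g \<ge> 3" "\<delta> \<ge> 2" shows "n1_star \<delta> g \<le> card X"
proof -
  define t where "t = (g - 1) div 2"
  have t: "t \<ge> 1" "g = 2 * t + 1 \<or> g = 2 * t + 2" using assms(1) by (auto simp: t_def)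
  then show ?thesis
    using card_ge_odd[of t] card_ge_even[of t] assms(2)
    unfolding n1_star_def t_def[symmetric] Let_def by auto
qed

end

section \<open>Laplacian forms and the main theorem\<close>

definition edges_between :: "'a set set \<Rightarrow> 'a set \<Rightarrow> 'a set \<Rightarrow> nat" where
  "edges_between E X Y = (\<Sum>u\<in>X. card (nbrs E u \<inter> Y))"

context
  fixes V :: "'a set" and E :: "'a set set"
  assumes graph: "simple_graph V E"
begin

lemma finite_vertices: "finite V"
  using graph by (simp add: simple_graph_def)

lemma nbrs_subset: "nbrs E u \<subseteq> V"
  using graph by (auto simp: nbrs_def simple_graph_def)

lemma finite_neighbours: "finite (nbrs E u)"
  using nbrs_subset finite_vertices by (rule finite_subset)

lemma card_nbrs: "card (nbrs E v) = vdegree E v"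
proof -
  have "{e \<in> E. v \<in> e} = (\<lambda>u. {v, u}) ` nbrs E v"
  proof (intro equalityI subsetI)
    fix e assume e: "e \<in> {e \<in> E. v \<in> e}"
    then have "card e = 2" using simple_graph_edges(2)[OF graph, of e] by simp
    then obtain u where "e = {v, u}" using e by (auto simp: card_2_iff)
    then show "e \<in> (\<lambda>u. {v, u}) ` nbrs E v" using e by (auto simp: nbrs_def)
  qed (auto simp: nbrs_def)
  moreover have "inj_on (\<lambda>u. {v, u}) (nbrs E v)"
    by (auto simp: inj_on_def doubleton_eq_iff)
  ultimately show ?thesis by (simp add: vdegree_def card_image)
qed

lemma sum_arcs_swap:
  fixes h :: "'a \<Rightarrow> 'a \<Rightarrow> real"
  shows "(\<Sum>u\<in>V. \<Sum>v\<in>nbrs E u. h u v) = (\<Sum>u\<in>V. \<Sum>v\<in>nbrs E u. h v u)"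
proof -
  have eq: "(\<Sum>u\<in>V. \<Sum>v\<in>nbrs E u. h u v) = (\<Sum>u\<in>V. \<Sum>v\<in>V. if {u, v} \<in> E then h u v else 0)"
    for h :: "'a \<Rightarrow> 'a \<Rightarrow> real"
  proof (rule sum.cong[OF refl])
    fix u
    have "V \<inter> {v. {u, v} \<in> E} = nbrs E u" using nbrs_subset[of u] by (auto simp: nbrs_def)
    then show "(\<Sum>v\<in>nbrs E u. h u v) = (\<Sum>v\<in>V. if {u, v} \<in> E then h u v else 0)"
      using finite_vertices by (simp add: sum.If_cases)
  qed
  show ?thesis
    unfolding eq by (subst sum.swap) (simp add: insert_commute)
qed

text \<open>The quadratic form of the Laplacian, on functions rather than vectors. The inner sums
  run over arcs, so each edge occurs twice; this explains the factor 2 in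
  \<open>dirichlet_eq\<close>.\<close>

definition dirichlet :: "('a \<Rightarrow> real) \<Rightarrow> real" where
  "dirichlet f = (\<Sum>u\<in>V. real (vdegree E u) * (f u)\<^sup>2) - (\<Sum>u\<in>V. \<Sum>v\<in>nbrs E u. f u * f v)"

lemma dirichlet_eq: "2 * dirichlet f = (\<Sum>u\<in>V. \<Sum>v\<in>nbrs E u. (f u - f v)\<^sup>2)"
proof -
  have "(\<Sum>u\<in>V. \<Sum>v\<in>nbrs E u. (f u - f v)\<^sup>2) =
      (\<Sum>u\<in>V. \<Sum>v\<in>nbrs E u. (f u)\<^sup>2) + (\<Sum>u\<in>V. \<Sum>v\<in>nbrs E u. (f v)\<^sup>2)
      - 2 * (\<Sum>u\<in>V. \<Sum>v\<in>nbrs E u. f u * f v)"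
    by (simp add: power2_diff sum.distrib sum_subtractf sum_distrib_left mult.assoc)
  also have "(\<Sum>u\<in>V. \<Sum>v\<in>nbrs E u. (f v)\<^sup>2) = (\<Sum>u\<in>V. \<Sum>v\<in>nbrs E u. (f u)\<^sup>2)"
    by (rule sum_arcs_swap)
  also have "(\<Sum>u\<in>V. \<Sum>v\<in>nbrs E u. (f u)\<^sup>2) = (\<Sum>u\<in>V. real (vdegree E u) * (f u)\<^sup>2)"
    by (simp add: card_nbrs)
  finally show ?thesis by (simp add: dirichlet_def)
qed

text \<open>In the worst case \<open>x\<close> and \<open>y\<close> have opposite signs and an edge between \<open>X\<close> and \<open>Y\<close>
  contributes \<open>(x - y)\<^sup>2 \<le> 2 x\<^sup>2 + 2 y\<^sup>2\<close>.\<close>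

lemma dirichlet_two_sets:
  assumes X: "X \<subseteq> V" and Y: "Y \<subseteq> V" and disj: "X \<inter> Y = {}"
  shows "dirichlet (\<lambda>u. x * of_bool (u \<in> X) + y * of_bool (u \<in> Y))
    \<le> (real (boundary E X) + real (edges_between E X Y)) * x\<^sup>2
      + (real (boundary E Y) + real (edges_between E X Y)) * y\<^sup>2"
proof -
  let ?f = "\<lambda>u. x * of_bool (u \<in> X) + y * of_bool (u \<in> Y)"
  \<comment> \<open>\<open>h\<close> charges the bound to arcs: \<open>x\<^sup>2\<close> for leaving
    \<open>X\<close>, \<open>y\<^sup>2\<close> for leaving \<open>Y\<close>, and both once more for
    an arc from \<open>X\<close> to \<open>Y\<close>. The two arcs of such an edge then carry
    \<open>2 * x\<^sup>2 + 2 * y\<^sup>2\<close>.\<close>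
  define h where "h u v = of_bool (u \<in> X \<and> v \<notin> X) * x\<^sup>2 + of_bool (u \<in> Y \<and> v \<notin> Y) * y\<^sup>2
    + of_bool (u \<in> X \<and> v \<in> Y) * (x\<^sup>2 + y\<^sup>2)" for u v
  have "(x - y)\<^sup>2 \<le> 2 * x\<^sup>2 + 2 * y\<^sup>2"
    using zero_le_power2[of "x + y"] by (simp add: power2_eq_square algebra_simps)
  moreover have "(y - x)\<^sup>2 = (x - y)\<^sup>2" by (rule power2_commute)
  ultimately have le: "(x - y)\<^sup>2 \<le> 2 * x\<^sup>2 + 2 * y\<^sup>2" "(y - x)\<^sup>2 \<le> 2 * x\<^sup>2 + 2 * y\<^sup>2"
    by simp_all
  have pointwise: "(?f u - ?f v)\<^sup>2 \<le> h u v + h v u" for u v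
  proof -
    have "u \<notin> X \<or> u \<notin> Y" "v \<notin> X \<or> v \<notin> Y" using disj by blast+
    then show ?thesis
      using le by (cases "u \<in> X"; cases "u \<in> Y"; cases "v \<in> X"; cases "v \<in> Y") (simp_all add: h_def)
  qed
  have count: "(\<Sum>u\<in>V. \<Sum>v\<in>nbrs E u. of_bool (u \<in> A \<and> v \<in> B)) = (\<Sum>u\<in>A. real (card (nbrs E u \<inter> B)))"
    if "A \<subseteq> V" for A B
  proof -
    have "(\<Sum>u\<in>V. \<Sum>v\<in>nbrs E u. of_bool (u \<in> A \<and> v \<in> B))
        = (\<Sum>u\<in>V. if u \<in> A then real (card (nbrs E u \<inter> B)) else 0)"
      using finite_neighbours by (intro sum.cong refl) (auto simp: Int_def)
    also have "\<dots> = (\<Sum>u\<in>A. real (card (nbrs E u \<inter> B)))"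
      using that finite_vertices by (simp add: sum.inter_restrict[symmetric] Int_absorb1)
    finally show ?thesis .
  qed
  have "2 * dirichlet ?f \<le> (\<Sum>u\<in>V. \<Sum>v\<in>nbrs E u. h u v + h v u)"
    unfolding dirichlet_eq by (intro sum_mono pointwise)
  also have "\<dots> = (\<Sum>u\<in>V. \<Sum>v\<in>nbrs E u. h u v) + (\<Sum>u\<in>V. \<Sum>v\<in>nbrs E u. h v u)"
    by (simp add: sum.distrib)
  also have "\<dots> = 2 * (\<Sum>u\<in>V. \<Sum>v\<in>nbrs E u. h u v)"
    using sum_arcs_swap[of h] by simp
  also have "(\<Sum>u\<in>V. \<Sum>v\<in>nbrs E u. h u v) =
      (\<Sum>u\<in>X. real (card (nbrs E u \<inter> - X))) * x\<^sup>2 + (\<Sum>u\<in>Y. real (card (nbrs E u \<inter> - Y))) * y\<^sup>2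
      + (\<Sum>u\<in>X. real (card (nbrs E u \<inter> Y))) * (x\<^sup>2 + y\<^sup>2)"
    unfolding h_def count[OF X, symmetric] count[OF Y, symmetric]
    by (simp add: sum.distrib sum_distrib_right)
  also have "\<dots> = (real (boundary E X) + real (edges_between E X Y)) * x\<^sup>2
      + (real (boundary E Y) + real (edges_between E X Y)) * y\<^sup>2"
    by (simp add: boundary_def out_degree_def edges_between_def Diff_eq algebra_simps)
  finally show ?thesis by simp
qed

end

section \<open>Quadratic forms of the graph matrices\<close>

lemma vertex_list:
  assumes "finite V" shows "distinct (vertex_list V)" "set (vertex_list V) = V"
proof -
  have "\<exists>vs. distinct vs \<and> set vs = V" using finite_distinct_list[OF assms] by blast
  then show "distinct (vertex_list V)" "set (vertex_list V) = V"
    unfolding vertex_list_def by (metis (mono_tags, lifting) someI_ex)+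
qed

definition vertex_vec :: "'a set \<Rightarrow> ('a \<Rightarrow> real) \<Rightarrow> real vec" where
  "vertex_vec V f = vec (card V) (\<lambda>i. f (vertex_list V ! i))"

lemma vertex_vec_carrier [simp]: "vertex_vec V f \<in> carrier_vec (card V)"
  by (simp add: vertex_vec_def)

lemma graph_matrices_carrier [simp]:
  "adjacency_matrix V E \<in> carrier_mat (card V) (card V)"
  "degree_matrix V E \<in> carrier_mat (card V) (card V)"
  "laplacian_matrix V E \<in> carrier_mat (card V) (card V)"
  "signless_laplacian_matrix V E \<in> carrier_mat (card V) (card V)"
proof -
  show A: "adjacency_matrix V E \<in> carrier_mat (card V) (card V)" by (simp add: adjacency_matrix_def)
  show D: "degree_matrix V E \<in> carrier_mat (card V) (card V)" by (simp add: degree_matrix_def)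
  show "laplacian_matrix V E \<in> carrier_mat (card V) (card V)"
    unfolding laplacian_matrix_def using A D by (intro minus_carrier_mat)
  show "signless_laplacian_matrix V E \<in> carrier_mat (card V) (card V)"
    unfolding signless_laplacian_matrix_def using A D by (intro add_carrier_mat)
qed

lemma graph_matrices_symmetric:
  "transpose_mat (adjacency_matrix V E) = adjacency_matrix V E"
  "transpose_mat (laplacian_matrix V E) = laplacian_matrix V E"
  "transpose_mat (signless_laplacian_matrix V E) = signless_laplacian_matrix V E"
  unfolding laplacian_matrix_def signless_laplacian_matrix_def
  by (rule eq_matI; auto simp: adjacency_matrix_def degree_matrix_def insert_commute)+

context
  fixes V :: "'a set" and E :: "'a set set"
  assumes graph: "simple_graph V E"
begin

text \<open>Frees sums over matrix indices from the chosen enumeration of the vertices.\<close>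

lemma sum_vertex_list: "(\<Sum>i<card V. h (vertex_list V ! i)) = (\<Sum>v\<in>V. h v)"
proof -
  note vs = vertex_list[OF finite_vertices[OF graph]]
  have "length (vertex_list V) = card V" using distinct_card[OF vs(1)] vs(2) by simp
  then have "bij_betw ((!) (vertex_list V)) {..<card V} V"
    using bij_betw_nth[OF vs(1) refl] vs(2) by simp
  then show ?thesis by (rule sum.reindex_bij_betw)
qed

lemma vertex_vec_norm: "vertex_vec V f \<bullet> vertex_vec V f = (\<Sum>v\<in>V. (f v)\<^sup>2)"
  unfolding sum_vertex_list[symmetric]
  by (simp add: vertex_vec_def scalar_prod_def lessThan_atLeast0 power2_eq_square)

lemma degree_form:
  "vertex_vec V f \<bullet> (degree_matrix V E *\<^sub>v vertex_vec V f) = (\<Sum>v\<in>V. real (vdegree E v) * (f v)\<^sup>2)"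
proof -
  let ?vs = "vertex_list V"
  have "(degree_matrix V E *\<^sub>v vertex_vec V f) $ i = real (vdegree E (?vs ! i)) * f (?vs ! i)"
    if i: "i < card V" for i
  proof -
    have "(degree_matrix V E *\<^sub>v vertex_vec V f) $ i =
        (\<Sum>j<card V. (if i = j then real (vdegree E (?vs ! i)) else 0) * f (?vs ! j))"
      using i by (simp add: vertex_vec_def degree_matrix_def scalar_prod_def lessThan_atLeast0)
    also have "\<dots> = (\<Sum>j<card V. if j = i then real (vdegree E (?vs ! i)) * f (?vs ! i) else 0)"
      by (intro sum.cong) auto
    finally show ?thesis using i by simp
  qed
  then show ?thesis
    unfolding sum_vertex_list[symmetric]
    by (simp add: vertex_vec_def scalar_prod_def lessThan_atLeast0 power2_eq_square mult_ac degree_matrix_def)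
qed

lemma adjacency_form:
  "vertex_vec V f \<bullet> (adjacency_matrix V E *\<^sub>v vertex_vec V f) = (\<Sum>u\<in>V. \<Sum>v\<in>nbrs E u. f u * f v)"
proof -
  let ?vs = "vertex_list V"
  have row: "(adjacency_matrix V E *\<^sub>v vertex_vec V f) $ i = (\<Sum>v\<in>nbrs E (?vs ! i). f v)"
    if i: "i < card V" for i
  proof -
    have "(adjacency_matrix V E *\<^sub>v vertex_vec V f) $ i =
        (\<Sum>j<card V. (if {?vs ! i, ?vs ! j} \<in> E then 1 else 0) * f (?vs ! j))"
      using i by (simp add: vertex_vec_def adjacency_matrix_def scalar_prod_def lessThan_atLeast0)
    also have "\<dots> = (\<Sum>v\<in>V. (if {?vs ! i, v} \<in> E then 1 else 0) * f v)"
      by (rule sum_vertex_list)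
    also have "\<dots> = (\<Sum>v\<in>nbrs E (?vs ! i). f v)"
      using nbrs_subset[OF graph] finite_vertices[OF graph]
      by (intro sum.mono_neutral_cong_right) (auto simp: nbrs_def)
    finally show ?thesis .
  qed
  have "vertex_vec V f \<bullet> (adjacency_matrix V E *\<^sub>v vertex_vec V f) =
      (\<Sum>i<card V. f (?vs ! i) * (adjacency_matrix V E *\<^sub>v vertex_vec V f) $ i)"
    by (simp add: vertex_vec_def scalar_prod_def lessThan_atLeast0 adjacency_matrix_def)
  also have "\<dots> = (\<Sum>i<card V. f (?vs ! i) * (\<Sum>v\<in>nbrs E (?vs ! i). f v))"
    by (intro sum.cong refl) (simp add: row)
  also have "\<dots> = (\<Sum>u\<in>V. f u * (\<Sum>v\<in>nbrs E u. f v))"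
    by (rule sum_vertex_list)
  finally show ?thesis by (simp add: sum_distrib_left)
qed

lemma laplacian_form:
  "vertex_vec V f \<bullet> (laplacian_matrix V E *\<^sub>v vertex_vec V f) = dirichlet V E f"
proof -
  have "laplacian_matrix V E *\<^sub>v vertex_vec V f =
      degree_matrix V E *\<^sub>v vertex_vec V f - adjacency_matrix V E *\<^sub>v vertex_vec V f"
    unfolding laplacian_matrix_def
    by (rule minus_mult_distrib_mat_vec[OF graph_matrices_carrier(2,1) vertex_vec_carrier])
  then show ?thesis
    by (simp add: scalar_prod_minus_distrib[OF vertex_vec_carrier mult_mat_vec_carrier[OF graph_matrices_carrier(2)]
          mult_mat_vec_carrier[OF graph_matrices_carrier(1)]] degree_form adjacency_form dirichlet_def[OF graph])
qed

text \<open>With the Laplacian \<open>L\<close> we have \<open>A = D - L\<close> and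
  \<open>D + A = 2 D - L\<close>, so one upper bound for the Dirichlet form and the degree bound
  serve all three matrices.\<close>

lemma adjacency_form_dirichlet:
  "vertex_vec V f \<bullet> (adjacency_matrix V E *\<^sub>v vertex_vec V f)
    = (\<Sum>v\<in>V. real (vdegree E v) * (f v)\<^sup>2) - dirichlet V E f"
  by (simp add: adjacency_form dirichlet_def[OF graph])

lemma signless_laplacian_form:
  "vertex_vec V f \<bullet> (signless_laplacian_matrix V E *\<^sub>v vertex_vec V f)
    = 2 * (\<Sum>v\<in>V. real (vdegree E v) * (f v)\<^sup>2) - dirichlet V E f"
proof -
  have "signless_laplacian_matrix V E *\<^sub>v vertex_vec V f =
      degree_matrix V E *\<^sub>v vertex_vec V f + adjacency_matrix V E *\<^sub>v vertex_vec V f"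
    unfolding signless_laplacian_matrix_def
    by (rule add_mult_distrib_mat_vec[OF graph_matrices_carrier(2,1) vertex_vec_carrier])
  then show ?thesis
    by (simp add: scalar_prod_add_distrib[OF vertex_vec_carrier mult_mat_vec_carrier[OF graph_matrices_carrier(2)]
          mult_mat_vec_carrier[OF graph_matrices_carrier(1)]] degree_form adjacency_form_dirichlet)
qed

text \<open>The indicators of disjoint sets are orthogonal, so the squared norm is
  \<open>card X * x\<^sup>2 + card Y * y\<^sup>2\<close>. Comparing coefficients with
  \<open>dirichlet_two_sets\<close> bounds the Dirichlet form by \<open>c\<close> times this
  norm.\<close>

lemma eigenvalue_bounds_two_sets:
  assumes X: "X \<subseteq> V" "X \<noteq> {}" and Y: "Y \<subseteq> V" "Y \<noteq> {}" and disj: "X \<inter> Y = {}"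
    and cX: "real (boundary E X) + real (edges_between E X Y) \<le> c * real (card X)"
    and cY: "real (boundary E Y) + real (edges_between E X Y) \<le> c * real (card Y)"
    and degree: "\<And>v. v \<in> V \<Longrightarrow> \<delta> \<le> vdegree E v"
  shows "real \<delta> - c \<le> adj_eig V E 2" "lap_eig V E (card V - 1) \<le> c"
    "2 * real \<delta> - c \<le> signless_eig V E 2"
proof -
  define f where "f x y = (\<lambda>v. x * of_bool (v \<in> X) + y * of_bool (v \<in> Y) :: real)" for x y
  define p where "p = vertex_vec V (\<lambda>v. of_bool (v \<in> X))"
  define q where "q = vertex_vec V (\<lambda>v. of_bool (v \<in> Y))"
  have pq: "p \<in> carrier_vec (card V)" "q \<in> carrier_vec (card V)" by (simp_all add: p_def q_def)
  have comb: "x \<cdot>\<^sub>v p + y \<cdot>\<^sub>v q = vertex_vec V (f x y)" for x y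
    by (rule eq_vecI) (simp_all add: p_def q_def f_def vertex_vec_def)
  have fin: "finite V" "finite X" "finite Y"
    using finite_vertices[OF graph] X Y finite_subset by blast+
  have pos: "card X > 0" "card Y > 0" using fin X Y by (simp_all add: card_gt_0_iff)
  have nrm: "(\<Sum>v\<in>V. (f x y v)\<^sup>2) = real (card X) * x\<^sup>2 + real (card Y) * y\<^sup>2" for x y
  proof -
    have "(\<Sum>v\<in>V. (f x y v)\<^sup>2) = (\<Sum>v\<in>V. of_bool (v \<in> X) * x\<^sup>2 + of_bool (v \<in> Y) * y\<^sup>2)"
      using disj by (intro sum.cong refl) (auto simp: f_def of_bool_def)
    also have "\<dots> = real (card X) * x\<^sup>2 + real (card Y) * y\<^sup>2"
      using fin X(1) Y(1)
      by (simp add: sum.distrib Int_absorb1 Int_def[symmetric] flip: sum_distrib_right)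
    finally show ?thesis .
  qed
  have indep: "x = 0 \<and> y = 0" if "x \<cdot>\<^sub>v p + y \<cdot>\<^sub>v q = 0\<^sub>v (card V)" for x y
  proof -
    have "vertex_vec V (f x y) \<bullet> vertex_vec V (f x y) = 0" using that unfolding comb by simp
    then have "real (card X) * x\<^sup>2 + real (card Y) * y\<^sup>2 = 0" by (simp add: vertex_vec_norm nrm)
    then show ?thesis using pos by (simp add: add_nonneg_eq_0_iff)
  qed
  have energy: "dirichlet V E (f x y) \<le> c * (\<Sum>v\<in>V. (f x y v)\<^sup>2)" for x y
  proof -
    have "dirichlet V E (f x y) \<le> (real (boundary E X) + real (edges_between E X Y)) * x\<^sup>2
      + (real (boundary E Y) + real (edges_between E X Y)) * y\<^sup>2"
      unfolding f_def by (rule dirichlet_two_sets[OF graph X(1) Y(1) disj])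
    also have "\<dots> \<le> (c * real (card X)) * x\<^sup>2 + (c * real (card Y)) * y\<^sup>2"
      using cX cY by (intro add_mono mult_right_mono) simp_all
    finally show ?thesis by (simp add: nrm algebra_simps)
  qed
  have deg: "real \<delta> * (\<Sum>v\<in>V. (f x y v)\<^sup>2) \<le> (\<Sum>v\<in>V. real (vdegree E v) * (f x y v)\<^sup>2)" for x y
    unfolding sum_distrib_left using degree by (intro sum_mono mult_right_mono) simp_all
  have "card X + card Y \<le> card V"
    using card_mono[OF fin(1), of "X \<union> Y"] card_Un_disjoint[OF fin(2,3) disj] X Y by simp
  then have n: "card V > 1" using pos by linarith
  then have n0: "card V > 0" by simp
  show "real \<delta> - c \<le> adj_eig V E 2"
    unfolding adj_eig_def
  proof (rule second_largest_eigenvalue_ge[OF _ graph_matrices_symmetric(1) pq n0 indep])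
    fix x y
    show "(real \<delta> - c) * ((x \<cdot>\<^sub>v p + y \<cdot>\<^sub>v q) \<bullet> (x \<cdot>\<^sub>v p + y \<cdot>\<^sub>v q))
      \<le> (x \<cdot>\<^sub>v p + y \<cdot>\<^sub>v q) \<bullet> (adjacency_matrix V E *\<^sub>v (x \<cdot>\<^sub>v p + y \<cdot>\<^sub>v q))"
      unfolding comb adjacency_form_dirichlet vertex_vec_norm
      using energy[of x y] deg[of x y] by (simp add: left_diff_distrib)
  qed simp_all
  show "lap_eig V E (card V - 1) \<le> c"
    unfolding lap_eig_def
  proof (rule second_smallest_eigenvalue_le[OF _ graph_matrices_symmetric(2) pq n indep])
    fix x y
    show "(x \<cdot>\<^sub>v p + y \<cdot>\<^sub>v q) \<bullet> (laplacian_matrix V E *\<^sub>v (x \<cdot>\<^sub>v p + y \<cdot>\<^sub>v q))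
      \<le> c * ((x \<cdot>\<^sub>v p + y \<cdot>\<^sub>v q) \<bullet> (x \<cdot>\<^sub>v p + y \<cdot>\<^sub>v q))"
      unfolding comb laplacian_form vertex_vec_norm by (rule energy)
  qed simp_all
  show "2 * real \<delta> - c \<le> signless_eig V E 2"
    unfolding signless_eig_def
  proof (rule second_largest_eigenvalue_ge[OF _ graph_matrices_symmetric(3) pq n0 indep])
    fix x y
    show "(2 * real \<delta> - c) * ((x \<cdot>\<^sub>v p + y \<cdot>\<^sub>v q) \<bullet> (x \<cdot>\<^sub>v p + y \<cdot>\<^sub>v q))
      \<le> (x \<cdot>\<^sub>v p + y \<cdot>\<^sub>v q) \<bullet> (signless_laplacian_matrix V E *\<^sub>v (x \<cdot>\<^sub>v p + y \<cdot>\<^sub>v q))"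
      unfolding comb signless_laplacian_form vertex_vec_norm
      using energy[of x y] deg[of x y] by (simp add: left_diff_distrib)
  qed simp_all
qed

end

section \<open>Two parts of a partition with few crossing edges\<close>

text \<open>Both sides count the arcs between different parts, once by the part containing the tail
  and once by the underlying edge, which carries two arcs.\<close>

lemma sum_boundary:
  assumes graph: "simple_graph V E" and P: "partition_on V P"
  shows "(\<Sum>X\<in>P. boundary E X) = 2 * card {e \<in> E. \<forall>X\<in>P. \<not> e \<subseteq> X}"
proof -
  define C where "C = {e \<in> E. \<forall>X\<in>P. \<not> e \<subseteq> X}"
  have finV: "finite V" using graph by (simp add: simple_graph_def)
  have finP: "finite P" using finite_elements[OF finV P] .
  have finX: "finite X" if "X \<in> P" for X
  proof (rule finite_subset[OF _ finV])
    show "X \<subseteq> V" unfolding partition_onD1[OF P] using that by (rule Union_upper)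
  qed
  have disj: "X \<inter> Y = {}" if "X \<in> P" "Y \<in> P" "X \<noteq> Y" for X Y
    by (rule disjointD[OF partition_onD2[OF P] that])
  have "(\<Sum>X\<in>P. boundary E X) = (\<Sum>X\<in>P. card (SIGMA u:X. nbrs E u - X))"
    unfolding boundary_def out_degree_def
    using finX finite_neighbours[OF graph] by (intro sum.cong refl) simp
  also have "\<dots> = card (\<Union>X\<in>P. SIGMA u:X. nbrs E u - X)"
  proof (rule card_UN_disjoint[symmetric, OF finP])
    show "\<forall>X\<in>P. finite (SIGMA u:X. nbrs E u - X)"
      using finX finite_neighbours[OF graph] by (intro ballI finite_SigmaI) simp_all
    show "\<forall>X\<in>P. \<forall>Y\<in>P. X \<noteq> Y \<longrightarrow> (SIGMA u:X. nbrs E u - X) \<inter> (SIGMA u:Y. nbrs E u - Y) = {}"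
    proof (intro ballI impI)
      fix X Y assume "X \<in> P" "Y \<in> P" "X \<noteq> Y"
      from disj[OF this] show "(SIGMA u:X. nbrs E u - X) \<inter> (SIGMA u:Y. nbrs E u - Y) = {}" by blast
    qed
  qed
  also have "(\<Union>X\<in>P. SIGMA u:X. nbrs E u - X) = (\<Union>e\<in>C. {(u, v). {u, v} = e})"
  proof (intro equalityI subsetI)
    fix a assume "a \<in> (\<Union>X\<in>P. SIGMA u:X. nbrs E u - X)"
    then obtain X where "X \<in> P" "a \<in> (SIGMA u:X. nbrs E u - X)" by (rule UN_E)
    moreover obtain u v where "a = (u, v)" by (cases a)
    ultimately have a: "a = (u, v)" "X \<in> P" "u \<in> X" "{u, v} \<in> E" "v \<notin> X"
      by (simp_all add: nbrs_def)
    have "\<not> {u, v} \<subseteq> Y" if "Y \<in> P" for Y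
      using disj[OF a(2) that] a(3,5) by (cases "X = Y") auto
    then have "{u, v} \<in> C" using a(4) by (simp add: C_def)
    then show "a \<in> (\<Union>e\<in>C. {(u, v). {u, v} = e})" unfolding a(1) by simp
  next
    fix a assume "a \<in> (\<Union>e\<in>C. {(u, v). {u, v} = e})"
    moreover obtain u v where a1: "a = (u, v)" by (cases a)
    ultimately have a: "a = (u, v)" "{u, v} \<in> C" by simp_all
    then have uv: "{u, v} \<in> E" "\<forall>X\<in>P. \<not> {u, v} \<subseteq> X" unfolding C_def by simp_all
    have "u \<in> V" using uv(1) simple_graph_edges(3)[OF graph] by blast
    then obtain X where X: "X \<in> P" "u \<in> X" using partition_onD1[OF P] by blast
    then have "v \<notin> X" using uv(2) by simp
    then have "a \<in> (SIGMA u:X. nbrs E u - X)" using a(1) uv(1) X(2) by (simp add: nbrs_def)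
    then show "a \<in> (\<Union>X\<in>P. SIGMA u:X. nbrs E u - X)" using X(1) by blast
  qed
  also have "card \<dots> = (\<Sum>e\<in>C. card {(u, v). {u, v} = e})"
  proof (rule card_UN_disjoint)
    show "finite C" using simple_graph_edges(1)[OF graph] by (simp add: C_def)
    show "\<forall>e\<in>C. finite {(u, v). {u, v} = e}"
    proof
      fix e assume "e \<in> C"
      then have "card e = 2" using simple_graph_edges(2)[OF graph, of e] by (simp add: C_def)
      then have "finite e" using card.infinite[of e] by force
      then have "finite (e \<times> e)" by simp
      moreover have "{(u, v). {u, v} = e} \<subseteq> e \<times> e" by auto
      ultimately show "finite {(u, v). {u, v} = e}" by (rule rev_finite_subset)
    qed
    show "\<forall>e\<in>C. \<forall>e'\<in>C. e \<noteq> e' \<longrightarrow> {(u, v). {u, v} = e} \<inter> {(u, v). {u, v} = e'} = {}"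
      by (simp add: disjoint_iff)
  qed
  also have "\<dots> = (\<Sum>e\<in>C. 2)"
  proof (rule sum.cong[OF refl])
    fix e assume "e \<in> C"
    then have "card e = 2" using simple_graph_edges(2)[OF graph, of e] by (simp add: C_def)
    then obtain x y where xy: "e = {x, y}" "x \<noteq> y" by (auto simp: card_2_iff)
    have "{(u, v). {u, v} = e} = {(x, y), (y, x)}" unfolding xy(1) doubleton_eq_iff by blast
    then show "card {(u, v). {u, v} = e} = 2" using xy by simp
  qed
  finally show ?thesis by (simp add: C_def)
qed

text \<open>The other parts are disjoint, so no neighbour outside \<open>X\<close> is counted
  twice.\<close>

lemma sum_edges_between_le:
  assumes graph: "simple_graph V E" and P: "partition_on V P" and X: "X \<in> P"
  shows "(\<Sum>Y\<in>P - {X}. edges_between E X Y) \<le> boundary E X"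
proof -
  have finV: "finite V" using graph by (simp add: simple_graph_def)
  have finP: "finite P" using finite_elements[OF finV P] .
  have "(\<Sum>Y\<in>P - {X}. edges_between E X Y) = (\<Sum>u\<in>X. \<Sum>Y\<in>P - {X}. card (nbrs E u \<inter> Y))"
    unfolding edges_between_def by (rule sum.swap)
  also have "\<dots> \<le> (\<Sum>u\<in>X. out_degree E X u)"
  proof (rule sum_mono)
    fix u
    have disj: "Y \<inter> Z = {}" if "Y \<in> P" "Z \<in> P" "Y \<noteq> Z" for Y Z
      using that partition_onD2[OF P] by (meson disjointD)
    have "(\<Sum>Y\<in>P - {X}. card (nbrs E u \<inter> Y)) = card (\<Union>Y\<in>P - {X}. nbrs E u \<inter> Y)"
    proof (rule card_UN_disjoint[symmetric])
      show "\<forall>Y\<in>P - {X}. \<forall>Z\<in>P - {X}. Y \<noteq> Z \<longrightarrow> nbrs E u \<inter> Y \<inter> (nbrs E u \<inter> Z) = {}"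
        using disj by blast
    qed (simp_all add: finP finite_neighbours[OF graph])
    also have "\<dots> \<le> card (nbrs E u - X)"
    proof (rule card_mono)
      show "(\<Union>Y\<in>P - {X}. nbrs E u \<inter> Y) \<subseteq> nbrs E u - X" using disj[OF X] by blast
    qed (simp add: finite_neighbours[OF graph])
    finally show "(\<Sum>Y\<in>P - {X}. card (nbrs E u \<inter> Y)) \<le> out_degree E X u"
      by (simp add: out_degree_def)
  qed
  finally show ?thesis by (simp add: boundary_def)
qed

text \<open>Take \<open>X\<close> with the smallest boundary: if no partner \<open>Y\<close> works, then
  \<open>boundary E Y + edges_between E X Y \<ge> 2 * k\<close> for all other parts \<open>Y\<close>, and summing over
  \<open>Y\<close> gives too many crossing edges.\<close>

lemma ex_two_parts:
  assumes graph: "simple_graph V E" and V: "V \<noteq> {}" and P: "partition_on V P"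
    and few: "card {e \<in> E. \<forall>X\<in>P. \<not> e \<subseteq> X} + k < k * card P"
  obtains X Y where "X \<in> P" "Y \<in> P" "X \<noteq> Y"
    "boundary E X + edges_between E X Y < 2 * k" "boundary E Y + edges_between E X Y < 2 * k"
proof -
  have finP: "finite P"
    using graph by (intro finite_elements[OF _ P]) (simp add: simple_graph_def)
  have "P \<noteq> {}" using V partition_onD1[OF P] by auto
  define X where "X = arg_min_on (boundary E) P"
  have X: "X \<in> P" "\<And>Y. Y \<in> P \<Longrightarrow> boundary E X \<le> boundary E Y"
    unfolding X_def using \<open>P \<noteq> {}\<close> by (simp_all add: arg_min_if_finite(1)[OF finP] arg_min_least[OF finP])
  have "\<exists>Y\<in>P - {X}. boundary E Y + edges_between E X Y < 2 * k"
  proof (rule ccontr)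
    assume "\<not> ?thesis"
    then have "(\<Sum>Y\<in>P - {X}. 2 * k) \<le> (\<Sum>Y\<in>P - {X}. boundary E Y + edges_between E X Y)"
      by (intro sum_mono) (simp add: not_less)
    also have "\<dots> \<le> (\<Sum>Y\<in>P - {X}. boundary E Y) + boundary E X"
      using sum_edges_between_le[OF graph P X(1)] by (simp add: sum.distrib)
    also have "\<dots> = (\<Sum>Y\<in>P. boundary E Y)"
      by (simp add: sum.remove[OF finP X(1)])
    finally have "card (P - {X}) * (2 * k) \<le> 2 * card {e \<in> E. \<forall>X\<in>P. \<not> e \<subseteq> X}"
      by (simp add: sum_boundary[OF graph P])
    moreover have "card P = Suc (card (P - {X}))" by (rule card.remove[OF finP X(1)])
    ultimately have "card P * (2 * k) \<le> 2 * card {e \<in> E. \<forall>X\<in>P. \<not> e \<subseteq> X} + 2 * k"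
      by (simp only: mult_Suc)
    moreover have "card P * (2 * k) = 2 * (k * card P)" by simp
    ultimately show False using few by linarith
  qed
  then obtain Y where Y: "Y \<in> P" "X \<noteq> Y" "boundary E Y + edges_between E X Y < 2 * k" by auto
  then have "boundary E X + edges_between E X Y < 2 * k" using X(2)[of Y] by linarith
  then show ?thesis by (rule that[OF X(1) Y(1,2) _ Y(3)])
qed

text \<open>Two distinct vertices make every spanning tree nonempty, so disjoint trees are distinct
  and form a set of \<open>k\<close> elements. On a single vertex they would all collapse to the
  empty edge set.\<close>

lemma tau_ge:
  assumes graph: "simple_graph V E" and two: "u \<in> V" "v \<in> V" "u \<noteq> v"
    and trees: "\<And>i. i < k \<Longrightarrow> is_spanning_tree V E (F i)" and disj: "disjoint_family_on F {..<k}"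
  shows "k \<le> tau V E"
proof -
  have nonempty: "F i \<noteq> {}" if "i < k" for i
  proof
    assume "F i = {}"
    moreover have "connected_graph V (F i)"
      using trees[OF that] by (simp add: is_spanning_tree_def is_tree_def)
    ultimately show False using two by (simp add: connected_graph_def)
  qed
  have "inj_on F {..<k}"
  proof (rule inj_onI)
    fix i j assume ij: "i \<in> {..<k}" "j \<in> {..<k}" "F i = F j"
    show "i = j"
      using disj ij nonempty[of i] unfolding disjoint_family_on_def by (metis Int_absorb lessThan_iff)
  qed
  then have card: "card (F ` {..<k}) = k" by (simp add: card_image)
  have pw: "pairwise disjnt (F ` {..<k})"
  proof (rule pairwiseI)
    fix A B assume "A \<in> F ` {..<k}" "B \<in> F ` {..<k}" "A \<noteq> B"
    then obtain i j where "A = F i" "B = F j" "i < k" "j < k" "i \<noteq> j" by auto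
    then show "disjnt A B" using disj by (simp add: disjnt_def disjoint_family_on_def)
  qed
  have "finite (Pow (Pow E))" using simple_graph_edges(1)[OF graph] by simp
  then have "finite (card ` Pow (Pow E))" by simp
  moreover have "{card \<T> | \<T>. (\<forall>F\<in>\<T>. is_spanning_tree V E F) \<and> pairwise disjnt \<T>} \<subseteq> card ` Pow (Pow E)"
    by (auto simp: is_spanning_tree_def)
  ultimately have "finite {card \<T> | \<T>. (\<forall>F\<in>\<T>. is_spanning_tree V E F) \<and> pairwise disjnt \<T>}"
    by (rule finite_subset[rotated])
  moreover have "k \<in> {card \<T> | \<T>. (\<forall>F\<in>\<T>. is_spanning_tree V E F) \<and> pairwise disjnt \<T>}"
    using card pw trees by (intro CollectI exI[of _ "F ` {..<k}"]) auto
  ultimately show ?thesis unfolding tau_def by (rule Max_ge)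
qed

section \<open>Contrapositive of the three spectral conditions\<close>

lemma eigenvalue_bounds_of_tau_less:
  assumes g: "g \<ge> 3" and k: "k \<ge> 2" and graph: "simple_graph V E"
    and \<delta>: "min_degree V E = \<delta>" "\<delta> \<ge> 2 * k" and girth: "girth E = enat g" and tau: "tau V E < k"
  shows "real \<delta> - (2 * real k - 1) / real (n1_star \<delta> g) \<le> adj_eig V E 2"
    "lap_eig V E (card V - 1) \<le> (2 * real k - 1) / real (n1_star \<delta> g)"
    "2 * real \<delta> - (2 * real k - 1) / real (n1_star \<delta> g) \<le> signless_eig V E 2"
proof -
  \<comment> \<open>A finite girth provides a cycle, and the cycle two distinct vertices, as
    \<open>tau_ge\<close> demands.\<close>
  have "{c. is_cycle E c} \<noteq> {}"
  proof
    assume "{c. is_cycle E c} = {}"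
    then have "girth E = \<infinity>" unfolding girth_def by (simp only: image_empty Inf_empty top_enat_def)
    then show False using girth by simp
  qed
  then obtain c where c: "is_cycle E c" by blast
  have cycles: "g \<le> length c" if "is_cycle E c" for c
  proof -
    have "girth E \<le> enat (length c)" unfolding girth_def using that by (intro INF_lower) simp
    then show ?thesis using girth by simp
  qed
  have "{c ! 0, c ! 1} \<in> E" "c ! 0 \<noteq> c ! 1"
    using c nth_eq_iff_index_eq[of c 0 1] unfolding is_cycle_def by (force dest: spec[of _ 0])+
  moreover from this have "c ! 0 \<in> V" "c ! 1 \<in> V" using graph by (auto simp: simple_graph_def)
  ultimately obtain u v where two: "u \<in> V" "v \<in> V" "u \<noteq> v" by blast
  have V: "V \<noteq> {}" using two(1) by force
  have degree: "\<delta> \<le> vdegree E v" if "v \<in> V" for v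
    using that \<delta>(1) graph unfolding min_degree_def by (auto simp: simple_graph_def)
  have "\<exists>P. partition_on V P \<and> card {e \<in> E. \<forall>X\<in>P. \<not> e \<subseteq> X} + k < k * card P"
  proof (rule ccontr)
    assume "\<not> ?thesis"
    then have cross: "\<And>P. partition_on V P \<Longrightarrow> k * card P \<le> card {e \<in> E. \<forall>X\<in>P. \<not> e \<subseteq> X} + k"
      by (meson not_le)
    have "k \<le> tau V E"
    proof (rule nash_williams_tutte[OF graph V])
      fix P assume "partition_on V P"
      then show "k * card P \<le> card {e \<in> E. \<forall>X\<in>P. \<not> e \<subseteq> X} + k" by (rule cross)
    next
      fix F assume "\<And>i. i < k \<Longrightarrow> is_spanning_tree V E (F i)" "disjoint_family_on F {..<k}"
      then show ?thesis by (rule tau_ge[OF graph two])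
    qed
    then show False using tau by simp
  qed
  then obtain P where P: "partition_on V P" "card {e \<in> E. \<forall>X\<in>P. \<not> e \<subseteq> X} + k < k * card P" by blast
  obtain X Y where XY: "X \<in> P" "Y \<in> P" "X \<noteq> Y"
    "boundary E X + edges_between E X Y < 2 * k" "boundary E Y + edges_between E X Y < 2 * k"
    by (rule ex_two_parts[OF graph V P])
  have part: "Z \<subseteq> V" "Z \<noteq> {}" if "Z \<in> P" for Z
    using that partition_onD1[OF P(1)] partition_onD3[OF P(1)] by auto
  have disj: "X \<inter> Y = {}" using XY partition_onD2[OF P(1)] by (meson disjointD)
  have large: "n1_star \<delta> g \<le> card Z" if Z: "Z \<in> P" "boundary E Z < 2 * k" for Z
  proof -
    interpret small_boundary V E g \<delta> Z
    proof
      show "\<delta> \<le> card (nbrs E v)" if "v \<in> V" for v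
        using degree[OF that] by (simp add: card_nbrs[OF graph])
    qed (use graph cycles part[OF Z(1)] Z(2) \<delta>(2) in auto)
    show ?thesis using n1_star_le_card g \<delta>(2) k by simp
  qed
  define N where "N = n1_star \<delta> g"
  have N: "N > 0" using g by (auto simp: N_def n1_star_def Let_def)
  have bound: "real (boundary E Z) + real (edges_between E X Y) \<le> (2 * real k - 1) / real N * real (card Z)"
    if Z: "Z \<in> P" "boundary E Z + edges_between E X Y < 2 * k" for Z
  proof -
    \<comment> \<open>The counts are integers, so being less than \<open>2 * k\<close> means being
      at most \<open>2 * k - 1\<close>.\<close>
    have "real (boundary E Z) + real (edges_between E X Y) \<le> 2 * real k - 1"
      using Z(2) by linarith
    also have "\<dots> = (2 * real k - 1) / real N * real N" using N by simp
    also have "\<dots> \<le> (2 * real k - 1) / real N * real (card Z)"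
      using large[OF Z(1)] Z(2) k unfolding N_def[symmetric] by (intro mult_left_mono) auto
    finally show ?thesis .
  qed
  note bounds = eigenvalue_bounds_two_sets[OF graph part[OF XY(1)] part[OF XY(2)] disj
      bound[OF XY(1,4)] bound[OF XY(2,5)] degree]
  show "real \<delta> - (2 * real k - 1) / real (n1_star \<delta> g) \<le> adj_eig V E 2"
    "lap_eig V E (card V - 1) \<le> (2 * real k - 1) / real (n1_star \<delta> g)"
    "2 * real \<delta> - (2 * real k - 1) / real (n1_star \<delta> g) \<le> signless_eig V E 2"
    using bounds unfolding N_def by simp_all
qed

theorem corollary1p8:
  fixes V :: "'a set" and E :: "'a set set" and g k n \<delta> :: nat
  assumes "g \<ge> 3" and "k \<ge> 2"
    and "simple_graph V E" and "card V = n"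
    and "min_degree V E = \<delta>" and "\<delta> \<ge> 2 * k"
    and "girth E = enat g"
  shows "(adj_eig V E 2 < real \<delta> - (2 * real k - 1) / real (n1_star \<delta> g) \<longrightarrow> tau V E \<ge> k) \<and>
         (lap_eig V E (n - 1) > (2 * real k - 1) / real (n1_star \<delta> g) \<longrightarrow> tau V E \<ge> k) \<and>
         (signless_eig V E 2 < 2 * real \<delta> - (2 * real k - 1) / real (n1_star \<delta> g) \<longrightarrow> tau V E \<ge> k)"
  using eigenvalue_bounds_of_tau_less[OF assms(1-3,5-7)] assms(4) by (meson not_le)

end
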